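(* Fix an integer $s\ge 1$. For each sufficiently large integer $k$, let $\Gamma=\Gamma_{s,k}$ be the Alon–Mehrabian abelian Cayley graph (defined in the context) on a group $G\cong\mathbb Z_2^{\,1+k(s+1)}$, with degree $d=2^k$ and order $n=2d^{s+1}$. Then $$ c_{1,\infty}(\Gamma)\le\frac nd=2d^s=2^{\frac1{s+1}}n^{\frac{s}{s+1}}. $$ Consequently, $$ c_{1,s}(\Gamma)=\Theta_s\left(n^{\frac{s}{s+1}}\right),\qquad c_{1,\infty}(\Gamma)=\Theta_s\left(n^{\frac{s}{s+1}}\right), $$ as $k\to\infty$.
   Context: Construction of $\Gamma_{s,k}$: let $F=\mathbb F_{2^k}$ be the field with $d:=2^k$ elements, enumerated as $x_1,\dots,x_d$. Identifying the additive group of $F$ with $\mathbb Z_2^k$, set $G:=\mathbb Z_2\times F^{s+1}\cong\mathbb Z_2^{\,1+k(s+1)}$. For $1\le i\le d$ let $$e_i:=\left(1,x_i,x_i^3,\dots,x_i^{2s+1}\right)\in G$$ (powers taken in $F$), let $S:=\{e_1,\dots,e_d\}$, and let $\Gamma_{s,k}:=\operatorname{Cay}(G,S)$, the graph with vertex set $G$ in which $x$ is adjacent to $x+g$ for every $x\in G$, $g\in S$. (It is undirected since $S=-S$; for fixed $s$ and all sufficiently large $k$ it is connected.) The game on a finite graph $\Gamma$ with speed-$1$ cops and a speed-$s$ robber: the cops choose their initial vertices first, then the robber chooses its initial vertex. Thereafter players alternate, the cops moving first in each round. On the cops' move each cop may remain where it is or move along one edge. On the robber's move, the robber may remain where it is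 or move along a path (no repeated vertices) of length at most $s$ no vertex of which (including the terminal vertex) is occupied by a cop. Capture occurs as soon as a cop and the robber occupy the same vertex. $c_{1,s}(\Gamma)$ is the least number of speed-$1$ cops that guarantee capture of a speed-$s$ robber. $c_{1,\infty}(\Gamma)$ is the corresponding number when the robber may traverse any finite cop-free path (of arbitrary length) in one turn. $\Theta_s(f)$ means bounded above and below by positive constant multiples of $f$ for all sufficiently large $k$, with constants and threshold depending only on $s$. *)

theory Defs
  imports
    Complex_Main
    "HOL-Library.Extended_Nat"
    "HOL-Algebra.Algebra"
    "Graph_Theory.Graph_Theory"
begin

section \<open>Cops and a fast robber\<close>

text \<open>
  The cops' position is the list of the vertices they occupy; several cops may share a vertex.
\<close>

definition cops_move :: "('v, 'e) pre_digraph \<Rightarrow> 'v list \<Rightarrow> 'v list \<Rightarrow> bool" where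
  "cops_move \<Gamma> C C' \<longleftrightarrow> list_all2 (\<lambda>u v. u = v \<or> u \<rightarrow>\<^bsub>\<Gamma>\<^esub> v) C C'"

text \<open>
  The speed is an extended natural number; for speed \<open>\<infinity>\<close> the length of the path is not bounded.
\<close>

definition robber_move :: "('v, 'e) pre_digraph \<Rightarrow> enat \<Rightarrow> 'v list \<Rightarrow> 'v \<Rightarrow> 'v \<Rightarrow> bool" where
  "robber_move \<Gamma> s C r r' \<longleftrightarrow>
     r' = r \<or>
     (\<exists>p. vpath p \<Gamma> \<and> hd p = r \<and> last p = r' \<and> enat (vwalk_length p) \<le> s \<and> set p \<inter> set C = {})"

text \<open>
  \<open>cops_win \<Gamma> s C r\<close>: with the cops at \<open>C\<close>, the robber at \<open>r\<close> and the cops to move, the cops can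
  force a capture. Since the predicate is inductive, the capture happens after finitely many rounds.
  A robber move never ends on a cop, so after it no capture has to be checked; \<open>captured\<close> covers
  a robber who chooses an occupied initial vertex.
\<close>

inductive cops_win :: "('v, 'e) pre_digraph \<Rightarrow> enat \<Rightarrow> 'v list \<Rightarrow> 'v \<Rightarrow> bool"
  for \<Gamma> :: "('v, 'e) pre_digraph" and s :: enat where
  captured: "r \<in> set C \<Longrightarrow> cops_win \<Gamma> s C r"
| capture: "cops_move \<Gamma> C C' \<Longrightarrow> r \<in> set C' \<Longrightarrow> cops_win \<Gamma> s C r"
| round: "cops_move \<Gamma> C C' \<Longrightarrow> r \<notin> set C' \<Longrightarrow>
    (\<And>r'. robber_move \<Gamma> s C' r r' \<Longrightarrow> cops_win \<Gamma> s C' r') \<Longrightarrow> cops_win \<Gamma> s C r"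

definition cops_suffice :: "('v, 'e) pre_digraph \<Rightarrow> enat \<Rightarrow> nat \<Rightarrow> bool" where
  "cops_suffice \<Gamma> s m \<longleftrightarrow>
     (\<exists>C. length C = m \<and> set C \<subseteq> verts \<Gamma> \<and> (\<forall>r \<in> verts \<Gamma>. cops_win \<Gamma> s C r))"

text \<open>
  The least number of speed-1 cops that guarantee the capture of a speed-\<open>s\<close> robber. On a finite
  graph it is well defined, because one cop on each vertex suffices.
\<close>

definition cop_number :: "('v, 'e) pre_digraph \<Rightarrow> enat \<Rightarrow> nat" where
  "cop_number \<Gamma> s = (LEAST m. cops_suffice \<Gamma> s m)"


section \<open>Cayley graphs and the Alon--Mehrabian construction\<close>

text \<open>
  Undirected graphs are represented as symmetric digraphs, as in the session Graph_Theory; the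
  relation below is symmetric when \<open>S\<close> is closed under inverses.
\<close>

definition Cay :: "('a, 'm) monoid_scheme \<Rightarrow> 'a set \<Rightarrow> ('a, 'a \<times> 'a) pre_digraph" where
  "Cay G S = with_proj
     \<lparr> pverts = carrier G, parcs = {(x, x \<otimes>\<^bsub>G\<^esub> g) | x g. x \<in> carrier G \<and> g \<in> S} \<rparr>"

text \<open>
  The group \<open>\<int>\<^sub>2 \<times> F\<^sup>s\<^sup>+\<^sup>1\<close>, whose second factor uses the additive group of the field \<open>F\<close>. The
  coordinates of \<open>F\<^sup>s\<^sup>+\<^sup>1\<close> are indexed by \<open>{..s}\<close>, so that coordinate \<open>j\<close> of the generator
  belonging to \<open>x\<close> is \<open>x\<^sup>2\<^sup>j\<^sup>+\<^sup>1\<close>.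
\<close>

definition AM_group :: "'a ring \<Rightarrow> nat \<Rightarrow> (int \<times> (nat \<Rightarrow> 'a)) monoid" where
  "AM_group F s = integer_mod_group 2 \<times>\<times> product_group {..s} (\<lambda>_. add_monoid F)"

definition AM_elt :: "'a ring \<Rightarrow> nat \<Rightarrow> 'a \<Rightarrow> int \<times> (nat \<Rightarrow> 'a)" where
  "AM_elt F s x = (1, \<lambda>j\<in>{..s}. x [^]\<^bsub>F\<^esub> (2 * j + 1))"

definition AM_graph :: "'a ring \<Rightarrow> nat \<Rightarrow>
    (int \<times> (nat \<Rightarrow> 'a), (int \<times> (nat \<Rightarrow> 'a)) \<times> (int \<times> (nat \<Rightarrow> 'a))) pre_digraph" where
  "AM_graph F s = Cay (AM_group F s) (AM_elt F s ` carrier F)"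

end

theory Submission
  imports Defs
begin

text \<open>
  The vertices with vanishing first coordinate in \<open>F\<^sup>s\<^sup>+\<^sup>1\<close> dominate the graph, and there are
  \<open>n / d\<close> of them; cops placed there win at once.

  For the lower bound, BCH theory shows that at most \<open>2s + 2\<close> distinct generators never sum to zero, so
  small sets of generators are determined by their sums. The robber at \<open>r\<close> considers the vertices
  \<open>r + \<Sigma>A\<close> for sets \<open>A\<close> of \<open>s\<close> generators, reached by adding the generators one by one. He maintains
  that at most \<open>\<epsilon> d\<^sup>j\<^sup>-\<^sup>1\<close> cops are within distance \<open>j\<close> of him, for \<open>1 \<le> j \<le> s\<close>. After
  the cops' move, few sets \<open>A\<close> have a partial sum that meets a cop. For the other sets each cop is near
  \<open>r + \<Sigma>A\<close> for few \<open>A\<close> only, so with at most \<open>c d\<^sup>s\<close> cops a counting argument yields a set \<open>A\<close> whose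
  end vertex satisfies the invariant again.
\<close>

section \<open>Elementary abelian 2-groups\<close>

locale elementary_abelian_2_group = comm_group G for G (structure) +
  assumes mult_self: "x \<in> carrier G \<Longrightarrow> x \<otimes> x = \<one>"
begin

text \<open>The factors over \<open>A \<inter> B\<close> occur twice and square to one, so only
  those in exactly one of the sets remain.\<close>

lemma finprod_sym_diff:
  assumes "finite A" "finite B" "f \<in> A \<union> B \<rightarrow> carrier G"
  shows "finprod G f A \<otimes> finprod G f B = finprod G f ((A - B) \<union> (B - A))"
proof -
  have c: "finprod G f Y \<in> carrier G" if "Y \<subseteq> A \<union> B" for Y
    using assms(3) that by (intro finprod_closed) auto
  have split: "finprod G f Y = finprod G f (Y - Z) \<otimes> finprod G f (A \<inter> B)"
    if "(Y, Z) = (A, B) \<or> (Y, Z) = (B, A)" for Y Z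
  proof -
    have "Y = (Y - Z) \<union> (A \<inter> B)" using that by auto
    moreover have "finprod G f ((Y - Z) \<union> (A \<inter> B)) = finprod G f (Y - Z) \<otimes> finprod G f (A \<inter> B)"
      using that assms by (intro finprod_Un_disjoint) auto
    ultimately show ?thesis by simp
  qed
  have ab: "a \<otimes> i \<otimes> (b \<otimes> i) = a \<otimes> b" if "a \<in> carrier G" "b \<in> carrier G" "i \<in> carrier G" for a b i
    using that mult_self[of i] by (metis m_assoc m_comm m_closed r_one)
  have "finprod G f A \<otimes> finprod G f B = finprod G f (A - B) \<otimes> finprod G f (B - A)"
    unfolding split[of A B, simplified] split[of B A, simplified] by (intro ab c) auto
  also have "\<dots> = finprod G f ((A - B) \<union> (B - A))"
    using assms by (intro finprod_Un_disjoint[symmetric]) auto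
  finally show ?thesis .
qed

lemma mult_cancel_self:
  assumes "x \<in> carrier G" "y \<in> carrier G"
  shows "x \<otimes> y \<otimes> y = x"
  using assms by (simp add: m_assoc mult_self)

text \<open>
  A maximal independent set \<open>B\<close> is a basis: an element outside the span of \<open>B\<close> could be added to it.
\<close>

lemma iso_product_group_integer_mod_group_2:
  assumes ord: "order G = 2 ^ N"
  shows "G \<cong> product_group {..<N} (\<lambda>_. integer_mod_group 2)"
proof -
  have fin: "finite (carrier G)"
    using ord by (metis card.infinite order_def power_eq_0_iff zero_neq_numeral)
  let ?prod = "finprod G (\<lambda>x. x)"
  have closed: "?prod D \<in> carrier G" if "D \<subseteq> carrier G" for D
    using that by (intro finprod_closed) auto
  \<comment> \<open>Distinct subsets having distinct products is linear independence over the field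
    with two elements.\<close>
  define P where "P B \<longleftrightarrow> B \<subseteq> carrier G \<and> inj_on ?prod (Pow B)" for B
  have "P {}" by (simp add: P_def)
  moreover have bound: "P B \<Longrightarrow> card B \<le> card (carrier G)" for B
    using fin by (simp add: P_def card_mono)
  ultimately obtain B where B: "P B" and max: "\<And>B'. P B' \<Longrightarrow> card B' \<le> card B"
    using ex_has_greatest_nat[of P "{}" card "Suc (card (carrier G))"] by (metis less_Suc_eq_le)
  have Bc: "B \<subseteq> carrier G" and inj: "inj_on ?prod (Pow B)" using B by (auto simp: P_def)
  have finB: "finite B" using Bc fin finite_subset by blast
  have pp: "?prod D \<otimes> ?prod E = ?prod ((D - E) \<union> (E - D))" if "D \<subseteq> B" "E \<subseteq> B" for D E
    using that Bc finB by (intro finprod_sym_diff) (auto intro: finite_subset)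
  have surj: "?prod ` Pow B = carrier G"
  proof (rule ccontr)
    assume "?prod ` Pow B \<noteq> carrier G"
    then obtain g where g: "g \<in> carrier G" "g \<notin> ?prod ` Pow B"
      using closed Bc by blast
    have gB: "g \<notin> B"
    proof
      assume "g \<in> B"
      then have "?prod {g} = g" using g by simp
      then show False using g(2) \<open>g \<in> B\<close> by (metis Pow_iff bot.extremum image_eqI insert_subset)
    qed
    have ins: "?prod (insert g D) = g \<otimes> ?prod D" if "D \<subseteq> B" for D
      using that gB g Bc finB by (intro finprod_insert) (auto intro: finite_subset)
    \<comment> \<open>This separates the products of subsets that contain \<open>g\<close> from
      those of subsets that do not, so that injectivity on \<open>Pow B\<close> extends to
      \<open>Pow (insert g B)\<close>.\<close>
    have ne: "g \<otimes> ?prod D \<noteq> ?prod E" if "D \<subseteq> B" "E \<subseteq> B" for D E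
    proof
      assume "g \<otimes> ?prod D = ?prod E"
      then have "?prod E \<otimes> ?prod D = g"
        using g that Bc closed mult_cancel_self by (metis subset_trans)
      then have "g = ?prod ((E - D) \<union> (D - E))" using pp that by simp
      then show False using g(2) that by blast
    qed
    have "inj_on ?prod (Pow (insert g B))"
    proof (rule inj_onI)
      fix D E assume D: "D \<in> Pow (insert g B)" and E: "E \<in> Pow (insert g B)" and eq: "?prod D = ?prod E"
      define D' E' where "D' = D - {g}" and "E' = E - {g}"
      have sub: "D' \<subseteq> B" "E' \<subseteq> B" using D E by (auto simp: D'_def E'_def)
      have cl: "?prod D' \<in> carrier G" "?prod E' \<in> carrier G" using sub Bc closed by auto
      have "?prod D = (if g \<in> D then g \<otimes> ?prod D' else ?prod D')"
        using ins[OF sub(1)] by (auto simp: D'_def insert_absorb)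
      moreover have "?prod E = (if g \<in> E then g \<otimes> ?prod E' else ?prod E')"
        using ins[OF sub(2)] by (auto simp: E'_def insert_absorb)
      ultimately have "(g \<in> D \<longleftrightarrow> g \<in> E) \<and> ?prod D' = ?prod E'"
        using eq ne sub cl g(1) by (auto split: if_splits) metis+
      then have "(g \<in> D \<longleftrightarrow> g \<in> E) \<and> D' = E'"
        using inj sub by (auto dest: inj_onD)
      then show "D = E" by (auto simp: D'_def E'_def)
    qed
    then have "P (insert g B)" using Bc g by (simp add: P_def)
    then show False using max[of "insert g B"] gB finB by simp
  qed
  have "card (carrier G) = 2 ^ card B"
    using card_image[OF inj] surj finB by (simp add: card_Pow)
  then have cardB: "card B = N" using ord by (simp add: order_def)
  then obtain b where b: "bij_betw b {..<N} B"
    using finB by (metis ex_bij_betw_nat_finite lessThan_atLeast0)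
  let ?H = "product_group {..<N} (\<lambda>_. integer_mod_group 2)"
  \<comment> \<open>A 0-1 vector is read as the indicator function of a set of basis elements;
    addition mod 2 then becomes symmetric difference, which \<open>pp\<close> turns into the group
    operation.\<close>
  define D where "D f = b ` {i \<in> {..<N}. f i = (1::int)}" for f :: "nat \<Rightarrow> int"
  have DB: "D f \<subseteq> B" for f using b by (auto simp: D_def bij_betw_def)
  have "bij_betw D (carrier ?H) (Pow B)"
  proof (rule bij_betw_byWitness[where f' = "\<lambda>E. \<lambda>i\<in>{..<N}. if b i \<in> E then 1 else 0"])
    have binj: "b i = b j \<longleftrightarrow> i = j" if "i < N" "j < N" for i j
      using b that by (auto simp: bij_betw_def inj_on_def)
    show "\<forall>f\<in>carrier ?H. (\<lambda>i\<in>{..<N}. if b i \<in> D f then 1 else 0) = f"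
    proof
      fix f assume f: "f \<in> carrier ?H"
      show "(\<lambda>i\<in>{..<N}. if b i \<in> D f then 1 else 0) = f"
      proof
        fix i
        have "f i = 0 \<or> f i = 1" if "i < N"
          using f that by (force simp: carrier_integer_mod_group PiE_iff)
        moreover have "b i \<in> D f \<longleftrightarrow> f i = 1" if "i < N"
          using that binj by (auto simp: D_def)
        ultimately show "(\<lambda>i\<in>{..<N}. if b i \<in> D f then 1 else 0) i = f i"
          using f by (cases "i < N") (auto simp: PiE_iff extensional_def)
      qed
    qed
    show "\<forall>E\<in>Pow B. D (\<lambda>i\<in>{..<N}. if b i \<in> E then 1 else 0) = E"
    proof
      fix E assume "E \<in> Pow B"
      moreover have "B = b ` {..<N}" using b by (simp add: bij_betw_def)
      ultimately show "D (\<lambda>i\<in>{..<N}. if b i \<in> E then 1 else 0) = E"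
        unfolding D_def by (auto split: if_splits)
    qed
    show "D ` carrier ?H \<subseteq> Pow B" using DB by auto
    show "(\<lambda>E. \<lambda>i\<in>{..<N}. if b i \<in> E then 1 else 0) ` Pow B \<subseteq> carrier ?H"
      by (auto simp: carrier_integer_mod_group)
  qed
  moreover have "bij_betw ?prod (Pow B) (carrier G)"
    using inj surj by (simp add: bij_betw_def)
  ultimately have bij: "bij_betw (\<lambda>f. ?prod (D f)) (carrier ?H) (carrier G)"
    using bij_betw_trans[of D _ _ ?prod] by (simp add: comp_def)
  have "(\<lambda>f. ?prod (D f)) \<in> hom ?H G"
  proof (rule homI)
    fix f g assume f: "f \<in> carrier ?H" and g: "g \<in> carrier ?H"
    show "?prod (D f) \<in> carrier G" using DB Bc closed by blast
    have "(f i + g i) mod 2 = 1 \<longleftrightarrow> (f i = 1) \<noteq> (g i = 1)" if "i < N" for i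
    proof -
      have "f i \<in> {0..<2}" "g i \<in> {0..<2}"
        using f g that by (auto simp: carrier_integer_mod_group PiE_iff)
      then have "f i = 0 \<or> f i = 1" "g i = 0 \<or> g i = 1" by auto
      then show ?thesis by auto
    qed
    then have eq: "{i \<in> {..<N}. (f \<otimes>\<^bsub>?H\<^esub> g) i = 1}
        = ({i \<in> {..<N}. f i = 1} - {i \<in> {..<N}. g i = 1}) \<union> ({i \<in> {..<N}. g i = 1} - {i \<in> {..<N}. f i = 1})"
      by auto
    have diff: "b ` (Y - Z) = b ` Y - b ` Z" if "Y \<subseteq> {..<N}" "Z \<subseteq> {..<N}" for Y Z
      using b that by (meson bij_betw_imp_inj_on inj_on_image_set_diff subset_trans Diff_subset)
    have "D (f \<otimes>\<^bsub>?H\<^esub> g) = (D f - D g) \<union> (D g - D f)"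
      unfolding D_def eq image_Un by (subst (1 2) diff, auto)
    then show "?prod (D (f \<otimes>\<^bsub>?H\<^esub> g)) = ?prod (D f) \<otimes> ?prod (D g)"
      using pp DB by simp
  qed
  then have iso: "?H \<cong> G" using bij by (auto simp: is_iso_def iso_def)
  have "group ?H" by simp
  then show ?thesis using iso by (rule group.iso_sym)
qed

end

section \<open>Power sums in fields of characteristic 2\<close>

text \<open>The additive order \<open>2 ^ k\<close> annihilates \<open>\<one>\<close>, so the
  \<open>k\<close>-th power of \<open>\<one> \<oplus> \<one>\<close> is zero, and a field has no
  zero divisors.\<close>

lemma (in field) char_2_if_card_power_2:
  assumes "card (carrier R) = 2 ^ k" and x: "x \<in> carrier R"
  shows "x \<oplus> x = \<zero>"
proof -
  let ?two = "\<one> \<oplus> \<one>"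
  have pow: "[((2::nat) ^ j)] \<cdot> \<one> = ?two [^] j" for j
  proof (induction j)
    case (Suc j)
    have "[((2::nat) ^ Suc j)] \<cdot> \<one> = [((2::nat) ^ j)] \<cdot> \<one> \<oplus> [((2::nat) ^ j)] \<cdot> \<one>"
      by (simp add: mult_2 add.nat_pow_mult)
    also have "\<dots> = ?two [^] j \<otimes> ?two"
      using Suc by (simp add: r_distr)
    finally show ?case by simp
  qed simp
  have "[(order (add_monoid R))] \<cdot> \<one> = \<zero>"
    using add.pow_order_eq_1[of \<one>] by simp
  then have "?two [^] k = \<zero>"
    using assms(1) pow[of k] by (simp add: order_def)
  then have "?two = \<zero>"
    by (induction k) (auto dest: integral)
  then show ?thesis
    using x by (metis l_distr l_null l_one one_closed)
qed

context field
begin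

text \<open>In characteristic 2 squaring is additive, so the odd power sums determine the even ones.\<close>

lemma power_sums_zero_if_odd_power_sums_zero:
  assumes char2: "\<And>x. x \<in> carrier R \<Longrightarrow> x \<oplus> x = \<zero>"
    and D: "D \<subseteq> carrier R" "finite D" "even (card D)"
    and odd: "\<And>j. j \<le> s \<Longrightarrow> (\<Oplus>x\<in>D. x [^] (2 * j + 1)) = \<zero>"
    and "p \<le> 2 * s + 2"
  shows "(\<Oplus>x\<in>D. x [^] (p::nat)) = \<zero>"
  using \<open>p \<le> 2 * s + 2\<close>
proof (induction p rule: less_induct)
  case (less p)
  have square_add: "(a \<oplus> b) \<otimes> (a \<oplus> b) = a \<otimes> a \<oplus> b \<otimes> b" if "a \<in> carrier R" "b \<in> carrier R" for a b
  proof -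
    have "(a \<oplus> b) \<otimes> (a \<oplus> b) = a \<otimes> a \<oplus> b \<otimes> b \<oplus> (a \<otimes> b \<oplus> a \<otimes> b)"
      using that by algebra
    then show ?thesis using that by (simp add: char2)
  qed
  have frobenius: "(\<Oplus>x\<in>E. f x) \<otimes> (\<Oplus>x\<in>E. f x) = (\<Oplus>x\<in>E. f x \<otimes> f x)"
    if "finite E" "f \<in> E \<rightarrow> carrier R" for E and f :: "'a \<Rightarrow> 'a"
    using that
  proof (induction E)
    case (insert a E)
    then have "f \<in> E \<rightarrow> carrier R" "f a \<in> carrier R" "(\<lambda>x. f x \<otimes> f x) \<in> E \<rightarrow> carrier R" by auto
    then show ?case using insert by (simp add: square_add)
  qed simp
  have pw: "(\<lambda>x. x [^] (q::nat)) \<in> D \<rightarrow> carrier R" for q using D by auto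
  \<comment> \<open>Exponent 0 gives the cardinality of \<open>D\<close> as a field element, which
    vanishes because it is even. A positive even exponent is reduced to its half by
    squaring.\<close>
  consider "p = 0" | j where "p = 2 * j + 1" | q where "p = 2 * q" "q \<noteq> 0"
    by (metis evenE oddE mult_0_right)
  then show ?case
  proof cases
    case 1
    obtain c where "card D = 2 * c" using D(3) by blast
    then have "[(card D)] \<cdot> \<one> = [c] \<cdot> \<one> \<oplus> [c] \<cdot> \<one>"
      by (simp add: mult_2 add.nat_pow_mult)
    then have "[(card D)] \<cdot> \<one> = \<zero>" by (simp add: char2)
    then show ?thesis using 1 add.finprod_const[of \<one> D] by simp
  next
    case 2
    then show ?thesis using odd[of j] less.prems by simp
  next
    case 3
    then have "(\<Oplus>x\<in>D. x [^] q) = \<zero>" using less by simp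
    then have "(\<Oplus>x\<in>D. x [^] q \<otimes> x [^] q) = \<zero>"
      using frobenius[OF D(2) pw[of q]] by simp
    moreover have "(\<Oplus>x\<in>D. x [^] p) = (\<Oplus>x\<in>D. x [^] q \<otimes> x [^] q)"
      using D 3 by (intro finsum_cong') (auto simp: nat_pow_mult mult_2)
    ultimately show ?thesis by simp
  qed
qed

text \<open>Summing the polynomial whose roots are all points of \<open>D\<close> but one over \<open>D\<close> leaves one nonzero term.\<close>

lemma empty_if_power_sums_zero:
  assumes D: "D \<subseteq> carrier R" "finite D" "card D \<le> n + 1"
    and zero: "\<And>p. p \<le> n \<Longrightarrow> (\<Oplus>x\<in>D. x [^] (p::nat)) = \<zero>"
  shows "D = {}"
proof (rule ccontr)
  assume "D \<noteq> {}"
  then obtain a where a: "a \<in> D" by blast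
  have cl: "(\<Otimes>y\<in>Y. x \<ominus> y) \<in> carrier R" if "Y \<subseteq> carrier R" "x \<in> carrier R" for Y x
    using that by (intro finprod_closed) auto
  \<comment> \<open>The additional factor \<open>x [^] p\<close> makes the induction on
    \<open>Y\<close> work: multiplying by \<open>x \<ominus> b\<close> gives a combination of the
    cases \<open>p + 1\<close> and \<open>p\<close> for the smaller set.\<close>
  have "(\<Oplus>x\<in>D. x [^] p \<otimes> (\<Otimes>y\<in>Y. x \<ominus> y)) = \<zero>"
    if "finite Y" "Y \<subseteq> D" "p + card Y \<le> n" for Y and p :: nat
    using that
  proof (induction Y arbitrary: p)
    case empty
    have "(\<Oplus>x\<in>D. x [^] p \<otimes> (\<Otimes>y\<in>{}. x \<ominus> y)) = (\<Oplus>x\<in>D. x [^] p)"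
      using D by (intro finsum_cong') auto
    then show ?case using zero[of p] empty by simp
  next
    case (insert b Y)
    then have b: "b \<in> carrier R" and Y: "Y \<subseteq> carrier R" using D by auto
    let ?P = "\<lambda>x. \<Otimes>y\<in>Y. x \<ominus> y"
    have "x [^] p \<otimes> (\<Otimes>y\<in>insert b Y. x \<ominus> y) = x [^] (p + 1) \<otimes> ?P x \<oplus> (\<ominus> b) \<otimes> (x [^] p \<otimes> ?P x)"
      if "x \<in> carrier R" for x
    proof -
      have "(\<Otimes>y\<in>insert b Y. x \<ominus> y) = (x \<ominus> b) \<otimes> ?P x"
        using insert b Y that by (intro finprod_insert) auto
      moreover have "z \<otimes> ((x \<ominus> b) \<otimes> q) = z \<otimes> x \<otimes> q \<oplus> (\<ominus> b) \<otimes> (z \<otimes> q)"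
        if "z \<in> carrier R" "q \<in> carrier R" for z q
        using that \<open>x \<in> carrier R\<close> b by algebra
      ultimately show ?thesis using cl[OF Y that] that by simp
    qed
    then have "(\<Oplus>x\<in>D. x [^] p \<otimes> (\<Otimes>y\<in>insert b Y. x \<ominus> y))
        = (\<Oplus>x\<in>D. x [^] (p + 1) \<otimes> ?P x \<oplus> (\<ominus> b) \<otimes> (x [^] p \<otimes> ?P x))"
      using D cl[OF Y] b by (intro finsum_cong') auto
    also have "\<dots> = (\<Oplus>x\<in>D. x [^] (p + 1) \<otimes> ?P x) \<oplus> (\<Oplus>x\<in>D. (\<ominus> b) \<otimes> (x [^] p \<otimes> ?P x))"
      using D cl[OF Y] b by (intro finsum_addf) auto
    also have "(\<Oplus>x\<in>D. (\<ominus> b) \<otimes> (x [^] p \<otimes> ?P x)) = (\<ominus> b) \<otimes> (\<Oplus>x\<in>D. x [^] p \<otimes> ?P x)"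
      using D cl[OF Y] b by (intro finsum_rdistr[symmetric]) auto
    finally show ?case using insert.IH[of p] insert.IH[of "p + 1"] insert.prems insert.hyps b by simp
  qed
  note sum_zero = this
  have cl_a: "(\<Otimes>y\<in>D - {a}. x \<ominus> y) \<in> carrier R" if "x \<in> D" for x
    using that D by (intro cl) auto
  \<comment> \<open>The polynomial has degree \<open>card D - 1\<close>, which is at most
    \<open>n\<close> by the bound on \<open>card D\<close>.\<close>
  from sum_zero[of "D - {a}" 0] have "(\<Oplus>x\<in>D. x [^] (0::nat) \<otimes> (\<Otimes>y\<in>D - {a}. x \<ominus> y)) = \<zero>"
    using D a by simp
  moreover have "(\<Oplus>x\<in>D. x [^] (0::nat) \<otimes> (\<Otimes>y\<in>D - {a}. x \<ominus> y))
      = (\<Oplus>x\<in>D. if a = x then (\<Otimes>y\<in>D - {a}. x \<ominus> y) else \<zero>)"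
  proof (intro finsum_cong')
    fix x assume x: "x \<in> D"
    have "(\<Otimes>y\<in>D - {a}. x \<ominus> y) = \<zero>" if "a \<noteq> x"
    proof -
      have "D - {a} = insert x (D - {a} - {x})" using that x by auto
      moreover have "(\<Otimes>y\<in>insert x (D - {a} - {x}). x \<ominus> y) = (x \<ominus> x) \<otimes> (\<Otimes>y\<in>D - {a} - {x}. x \<ominus> y)"
        using x D by (intro finprod_insert) auto
      moreover have "x \<ominus> x = \<zero>" using x D by (auto simp: minus_eq r_neg)
      moreover have "(\<Otimes>y\<in>D - {a} - {x}. x \<ominus> y) \<in> carrier R" using x D by (intro cl) auto
      ultimately show ?thesis by (metis l_null)
    qed
    then show "x [^] (0::nat) \<otimes> (\<Otimes>y\<in>D - {a}. x \<ominus> y) = (if a = x then (\<Otimes>y\<in>D - {a}. x \<ominus> y) else \<zero>)"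
      using x D cl_a[of x] by (cases "a = x") (force simp: subset_iff)+
  qed (use D cl_a in auto)
  moreover have "(\<Oplus>x\<in>D. if a = x then (\<Otimes>y\<in>D - {a}. x \<ominus> y) else \<zero>) = (\<Otimes>y\<in>D - {a}. a \<ominus> y)"
    using a D cl_a by (intro finsum_singleton) auto
  moreover have "(\<Otimes>y\<in>Y. a \<ominus> y) \<noteq> \<zero>" if "finite Y" "Y \<subseteq> D - {a}" for Y
    using that
  proof (induction Y)
    case (insert b Y)
    then have "(\<Otimes>y\<in>insert b Y. a \<ominus> y) = (a \<ominus> b) \<otimes> (\<Otimes>y\<in>Y. a \<ominus> y)"
      using D a by (intro finprod_insert) auto
    moreover have "a \<ominus> b \<noteq> \<zero>"
    proof
      assume z: "a \<ominus> b = \<zero>"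
      have ab: "a \<in> carrier R" "b \<in> carrier R" "a \<noteq> b" using insert D a by auto
      then have "a = (a \<ominus> b) \<oplus> b" by algebra
      then show False using z ab by simp
    qed
    moreover have "(\<Otimes>y\<in>Y. a \<ominus> y) \<in> carrier R" using insert D a by (intro cl) auto
    moreover have "a \<ominus> b \<in> carrier R" using insert D a by auto
    moreover have "(\<Otimes>y\<in>Y. a \<ominus> y) \<noteq> \<zero>" using insert by blast
    ultimately show ?case using integral by metis
  qed simp
  ultimately show False using D(2) by (metis finite_Diff subset_refl)
qed

end

section \<open>The robber's strategy on Cayley graphs with independent generators\<close>

lemma card_subsets_of_card_le:
  assumes "finite I"
  shows "card {B. B \<subseteq> I \<and> card B = l} \<le> card I ^ l"
  using assms binomial_le_pow[of l "card I"] by (cases "l \<le> card I") (auto simp: n_subsets binomial_eq_0)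

lemma card_subsets_of_card_at_most_le:
  assumes "finite I" "I \<noteq> {}"
  shows "card {B. B \<subseteq> I \<and> card B \<le> j} \<le> (j + 1) * card I ^ j"
proof -
  have "{B. B \<subseteq> I \<and> card B \<le> j} = (\<Union>l\<le>j. {B. B \<subseteq> I \<and> card B = l})" by auto
  then have "card {B. B \<subseteq> I \<and> card B \<le> j} \<le> (\<Sum>l\<le>j. card {B. B \<subseteq> I \<and> card B = l})"
    by (simp add: card_UN_le)
  also have "\<dots> \<le> (\<Sum>l\<le>j. card I ^ j)"
  proof (rule sum_mono)
    fix l assume "l \<in> {..j}"
    then have "card I ^ l \<le> card I ^ j"
      using assms by (intro power_increasing) (auto simp: Suc_le_eq card_gt_0_iff)
    then show "card {B. B \<subseteq> I \<and> card B = l} \<le> card I ^ j"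
      using card_subsets_of_card_le[OF assms(1), of l] by simp
  qed
  finally show ?thesis by simp
qed

text \<open>Double counting of the related pairs: each \<open>a\<close> in the set on the left has
  more than \<open>t\<close> partners, each \<open>i\<close> at most \<open>K\<close>.\<close>

lemma markov_inequality_card:
  fixes t :: real
  assumes "finite A" "finite I" "t \<ge> 0" and K: "\<And>i. i \<in> I \<Longrightarrow> card {a \<in> A. R a i} \<le> K"
  shows "t * card {a \<in> A. t < card {i \<in> I. R a i}} \<le> card I * K"
proof -
  let ?B = "{a \<in> A. t < card {i \<in> I. R a i}}"
  have "t * card ?B = (\<Sum>a\<in>?B. t)" by simp
  also have "\<dots> \<le> (\<Sum>a\<in>?B. real (card {i \<in> I. R a i}))" by (intro sum_mono) auto
  also have "\<dots> \<le> (\<Sum>a\<in>A. real (card {i \<in> I. R a i}))"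
    using assms(1) by (intro sum_mono2) auto
  also have "\<dots> = real (\<Sum>i\<in>I. card {a \<in> A. R a i})"
    using sum_multicount_gen[of A I R "\<lambda>i. card {a \<in> A. R a i}"] assms
    by (simp flip: of_nat_sum)
  also have "\<dots> \<le> real (\<Sum>i\<in>I. K)" by (intro of_nat_mono sum_mono K)
  finally show ?thesis by simp
qed

lemma vwalk_arcs_map_upt:
  "vwalk_arcs (map f [0..<Suc n]) = map (\<lambda>i. (f i, f (Suc i))) [0..<n]"
proof (induction n)
  case (Suc n)
  have "vwalk_arcs (map f [0..<Suc n] @ [f (Suc n)])
      = vwalk_arcs (map f [0..<Suc n]) @ (last (map f [0..<Suc n]), f (Suc n)) # vwalk_arcs [f (Suc n)]"
    by (subst vwalk_arcs_append) auto
  then show ?case using Suc by simp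
qed simp

lemma dominates_Cay_iff:
  "u \<rightarrow>\<^bsub>Cay G S\<^esub> v \<longleftrightarrow> u \<in> carrier G \<and> (\<exists>g\<in>S. v = u \<otimes>\<^bsub>G\<^esub> g)"
  by (auto simp: Cay_def)

lemma out_arcs_Cay:
  assumes "v \<in> carrier G"
  shows "out_arcs (Cay G S) v = (\<lambda>g. (v, v \<otimes>\<^bsub>G\<^esub> g)) ` S"
  using assms by (auto simp: out_arcs_def Cay_def)

text \<open>In the application \<open>I\<close> is the carrier of the field and \<open>e\<close>
  maps \<open>x\<close> to its generator. The bound \<open>2 * s + 2\<close> allows two sets of
  \<open>s + 1\<close> generators to be compared by their sums.\<close>

locale independent_generators = elementary_abelian_2_group +
  fixes I :: "'x set" and e :: "'x \<Rightarrow> 'a" and s :: nat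
  assumes finite_I: "finite I"
    and e_closed: "e \<in> I \<rightarrow> carrier G"
    and finite_G: "finite (carrier G)"
    and s_pos: "s \<ge> 1"
    and s_le: "s \<le> card I"
    and indep: "D \<subseteq> I \<Longrightarrow> card D \<le> 2 * s + 2 \<Longrightarrow> finprod G e D = \<one> \<Longrightarrow> D = {}"
begin

section \<open>Sums over sets of generators\<close>

abbreviation "sm \<equiv> finprod G e"

abbreviation "d \<equiv> card I"

abbreviation "\<Gamma> \<equiv> Cay G (e ` I)"

lemma sm_closed [simp]: "B \<subseteq> I \<Longrightarrow> sm B \<in> carrier G"
  using e_closed by (intro finprod_closed) auto

lemma finite_subset_I: "B \<subseteq> I \<Longrightarrow> finite B"
  using finite_I finite_subset by blast

lemma sm_mult: "A \<subseteq> I \<Longrightarrow> B \<subseteq> I \<Longrightarrow> sm A \<otimes> sm B = sm ((A - B) \<union> (B - A))"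
  using e_closed by (intro finprod_sym_diff) (auto intro: finite_subset_I)

lemma card_sym_diff_le: "A \<subseteq> I \<Longrightarrow> B \<subseteq> I \<Longrightarrow> card ((A - B) \<union> (B - A)) \<le> card A + card B"
  by (meson Diff_subset add_mono card_Un_le card_mono finite_subset_I order_trans)

lemma sm_insert: "B \<subseteq> I \<Longrightarrow> x \<in> I \<Longrightarrow> x \<notin> B \<Longrightarrow> sm (insert x B) = sm B \<otimes> e x"
  using e_closed finite_subset_I[of B] by (subst finprod_insert) (auto intro: m_comm)

text \<open>Equal sums make the sum over the symmetric difference trivial, and that set is small
  enough for independence.\<close>

lemma sm_inject:
  assumes "A \<subseteq> I" "B \<subseteq> I" "card A + card B \<le> 2 * s + 2" "sm A = sm B"
  shows "A = B"
proof -
  have "sm ((A - B) \<union> (B - A)) = \<one>"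
    using sm_mult[of A B] assms mult_self[of "sm B"] by simp
  then have "(A - B) \<union> (B - A) = {}"
    using assms card_sym_diff_le[of A B] by (intro indep) auto
  then show ?thesis by auto
qed

lemma d_pos: "d > 0"
  using s_pos s_le by linarith

text \<open>
  \<open>near j r u\<close> says that the distance from \<open>r\<close> to \<open>u\<close> is at most \<open>j\<close>: repeated generators cancel in
  a walk.
\<close>

definition near :: "nat \<Rightarrow> 'a \<Rightarrow> 'a \<Rightarrow> bool" where
  "near j r u \<longleftrightarrow> (\<exists>B \<subseteq> I. card B \<le> j \<and> u = r \<otimes> sm B)"

text \<open>Indices are counted instead of vertices, so cops sharing a vertex count separately and a
  move can be followed cop by cop.\<close>

definition ncops :: "nat \<Rightarrow> 'a list \<Rightarrow> 'a \<Rightarrow> nat" where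
  "ncops j C r = card {i \<in> {..<length C}. near j r (C ! i)}"

section \<open>Distances from the robber and moves in the graph\<close>

lemma verts_Cay [simp]: "verts \<Gamma> = carrier G"
  by (simp add: Cay_def)

lemma near_self: "r \<in> carrier G \<Longrightarrow> near j r r"
  unfolding near_def by (intro exI[of _ "{}"]) auto

text \<open>The arc is followed backwards, which is possible because each generator is its own
  inverse. Here \<open>u\<close> is a cop's vertex before its move and \<open>v\<close> the one
  after it.\<close>

lemma near_step:
  assumes r: "r \<in> carrier G" and v: "near j r v" and uv: "u = v \<or> u \<rightarrow>\<^bsub>\<Gamma>\<^esub> v"
  shows "near (Suc j) r u"
proof -
  obtain B where B: "B \<subseteq> I" "card B \<le> j" "v = r \<otimes> sm B" using v by (auto simp: near_def)
  show ?thesis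
  proof (cases "u = v")
    case True
    then show ?thesis using B unfolding near_def by (intro exI[of _ B]) auto
  next
    case False
    then obtain x where x: "u \<in> carrier G" "x \<in> I" "v = u \<otimes> e x"
      using uv by (auto simp: dominates_Cay_iff)
    have ex: "e x \<in> carrier G" using x(2) e_closed by auto
    then have sx: "sm {x} = e x" using sm_insert[of "{}" x] x(2) by simp
    have "u = v \<otimes> e x" using x ex mult_cancel_self by simp
    also have "\<dots> = r \<otimes> (sm B \<otimes> sm {x})" using B r x ex sx by (simp add: m_assoc)
    also have "\<dots> = r \<otimes> sm ((B - {x}) \<union> ({x} - B))" using sm_mult[of B "{x}"] B x by simp
    finally have "u = r \<otimes> sm ((B - {x}) \<union> ({x} - B))" .
    moreover have "card ((B - {x}) \<union> ({x} - B)) \<le> Suc j"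
      using card_sym_diff_le[of B "{x}"] B x by simp
    ultimately show ?thesis
      unfolding near_def using B(1) x(2) by (intro exI[of _ "(B - {x}) \<union> ({x} - B)"]) auto
  qed
qed

lemma ncops_cops_move:
  assumes r: "r \<in> carrier G" and move: "cops_move \<Gamma> C C'"
  shows "ncops j C' r \<le> ncops (Suc j) C r"
proof -
  have "length C = length C'" and "\<And>i. i < length C \<Longrightarrow> C ! i = C' ! i \<or> C ! i \<rightarrow>\<^bsub>\<Gamma>\<^esub> C' ! i"
    using move by (auto simp: cops_move_def list_all2_conv_all_nth)
  then show ?thesis
    unfolding ncops_def using near_step[OF r] by (intro card_mono) auto
qed

lemma cops_move_closed:
  assumes "cops_move \<Gamma> C C'" "set C \<subseteq> carrier G"
  shows "set C' \<subseteq> carrier G"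
proof
  fix v assume "v \<in> set C'"
  then obtain i where i: "i < length C'" "v = C' ! i" by (metis in_set_conv_nth)
  then have "C ! i = v \<or> C ! i \<rightarrow>\<^bsub>\<Gamma>\<^esub> v" "C ! i \<in> set C"
    using assms(1) by (auto simp: cops_move_def list_all2_conv_all_nth)
  then show "v \<in> carrier G" using assms(2) e_closed by (auto simp: dominates_Cay_iff)
qed

lemma ncops_pos:
  assumes "i < length C" "near j r (C ! i)"
  shows "ncops j C r > 0"
  using assms unfolding ncops_def by (subst card_gt_0_iff) auto

text \<open>The generators indexed by \<open>A\<close> are added one by one in an arbitrary order.
  The intermediate vertices belong to subsets of different sizes, so they are distinct by
  independence and the walk is a path.\<close>

lemma robber_move_along_set:
  assumes r: "r \<in> carrier G" "r \<notin> set C" and A: "A \<subseteq> I" "card A = s" and \<sigma>: "enat s \<le> \<sigma>"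
    and free: "\<And>A'. A' \<subseteq> A \<Longrightarrow> A' \<noteq> {} \<Longrightarrow> r \<otimes> sm A' \<notin> set C"
  shows "robber_move \<Gamma> \<sigma> C r (r \<otimes> sm A)"
proof -
  obtain xs where xs: "set xs = A" "distinct xs"
    using finite_distinct_list finite_subset_I[OF A(1)] by blast
  then have len: "length xs = s" using A distinct_card by force
  define f where "f i = r \<otimes> sm (set (take i xs))" for i
  define p where "p = map f [0..<Suc s]"
  have sub: "set (take i xs) \<subseteq> A" for i using xs set_take_subset by metis
  have subI: "set (take i xs) \<subseteq> I" for i using sub A by blast
  have cardt: "card (set (take i xs)) = i" if "i \<le> s" for i
    using that xs len by (simp add: distinct_card)
  have fc: "f i \<in> carrier G" for i using r subI by (simp add: f_def)
  have step: "f i \<rightarrow>\<^bsub>\<Gamma>\<^esub> f (Suc i)" if "i < s" for i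
  proof -
    have take: "take (Suc i) xs = take i xs @ [xs ! i]" using that len by (simp add: take_Suc_conv_app_nth)
    have xi: "xs ! i \<in> I" "xs ! i \<notin> set (take i xs)"
      using that len xs A nth_mem[of i xs] take distinct_take[of xs "Suc i"] by auto
    then have "f (Suc i) = f i \<otimes> e (xs ! i)"
      using sm_insert[OF subI xi] subI[of i] r funcset_mem[OF e_closed xi(1)]
      by (simp add: f_def take m_assoc)
    then show ?thesis
      unfolding dominates_Cay_iff using fc[of i] xi(1) by (intro conjI bexI[of _ "e (xs ! i)"]) auto
  qed
  have inj: "inj_on f {0..<Suc s}"
  proof (rule inj_onI)
    fix i j assume ij: "i \<in> {0..<Suc s}" "j \<in> {0..<Suc s}" "f i = f j"
    then have "sm (set (take i xs)) = sm (set (take j xs))"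
      using r subI by (simp add: f_def)
    then have "set (take i xs) = set (take j xs)"
      using subI cardt ij by (intro sm_inject) auto
    then show "i = j" using cardt ij by (metis atLeastLessThan_iff less_Suc_eq_le)
  qed
  have "vpath p \<Gamma>"
  proof
    show "vwalk p \<Gamma>"
    proof
      show "set p \<subseteq> verts \<Gamma>" using fc by (auto simp: p_def)
      show "set (vwalk_arcs p) \<subseteq> arcs_ends \<Gamma>" using step by (auto simp: p_def vwalk_arcs_map_upt simp del: upt_Suc)
    qed (simp add: p_def)
    show "distinct p" using inj by (simp add: p_def distinct_map del: upt_Suc)
  qed
  moreover have "hd p = r" using r by (simp add: p_def f_def hd_map del: upt_Suc)
  moreover have "last p = r \<otimes> sm A" using xs len by (simp add: p_def f_def)
  moreover have "set p \<inter> set C = {}"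
  proof -
    have "f i \<notin> set C" for i
    \<comment> \<open>The start of the path belongs to the empty partial sum, which
      \<open>free\<close> does not cover.\<close>
    proof (cases "set (take i xs) = {}")
      case True
      then show ?thesis using r by (simp add: f_def del: set_empty set_empty2)
    next
      case False
      then show ?thesis using free[OF sub] by (simp add: f_def)
    qed
    then show ?thesis by (auto simp: p_def)
  qed
  moreover have "vwalk_length p = s" by (simp add: p_def)
  ultimately show ?thesis using \<sigma> unfolding robber_move_def by metis
qed

text \<open>By independence at most one \<open>l\<close>-set \<open>D\<close> leads from
  \<open>r\<close> to \<open>u\<close>. Hence every \<open>A\<close> counted contains
  \<open>D\<close>, and only its other \<open>s - l\<close> elements are free.\<close>

lemma card_supersets_of_rep_le:
  assumes r: "r \<in> carrier G" and l: "l \<le> s"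
  shows "card {A. A \<subseteq> I \<and> card A = s \<and> (\<exists>A'\<subseteq>A. card A' = l \<and> u = r \<otimes> sm A')} \<le> d ^ (s - l)"
    (is "card ?S \<le> _")
proof (cases "?S = {}")
  case False
  then obtain D where D: "D \<subseteq> I" "card D = l" "u = r \<otimes> sm D" by blast
  have sup: "D \<subseteq> A" if "A \<in> ?S" for A
  proof -
    have "A \<subseteq> I" and "\<exists>A'\<subseteq>A. card A' = l \<and> u = r \<otimes> sm A'" using that by simp_all
    then obtain A' where A': "A' \<subseteq> A" "card A' = l" "u = r \<otimes> sm A'" by (elim exE conjE)
    then have "A' \<subseteq> I" "r \<otimes> sm A' = r \<otimes> sm D" using D(3) \<open>A \<subseteq> I\<close> by simp_all
    then have "sm A' = sm D" using D(1) r by simp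
    then have "A' = D" using A' D l \<open>A \<subseteq> I\<close> by (intro sm_inject) auto
    then show ?thesis using A'(1) by simp
  qed
  have "inj_on (\<lambda>A. A - D) ?S"
  proof (rule inj_onI)
    fix A B assume "A \<in> ?S" "B \<in> ?S" and eq: "A - D = B - D"
    then have "D \<subseteq> A" "D \<subseteq> B" by (simp_all only: sup)
    then show "A = B" using eq by blast
  qed
  moreover have "(\<lambda>A. A - D) ` ?S \<subseteq> {B. B \<subseteq> I \<and> card B = s - l}"
  proof
    fix B assume "B \<in> (\<lambda>A. A - D) ` ?S"
    then obtain A where "A \<in> ?S" "B = A - D" by (elim imageE)
    moreover from this have "D \<subseteq> A" by (intro sup)
    ultimately show "B \<in> {B. B \<subseteq> I \<and> card B = s - l}"
      using D finite_subset_I[OF D(1)] by (auto simp: card_Diff_subset)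
  qed
  ultimately have "card ?S \<le> card {B. B \<subseteq> I \<and> card B = s - l}"
    using finite_I by (intro card_inj_on_le) auto
  then show ?thesis using card_subsets_of_card_le[OF finite_I, of "s - l"] by linarith
qed (simp only: card.empty zero_le)

text \<open>All the sets \<open>insert b A\<close> coincide, by independence for two sets of size
  \<open>s + 1\<close>; each \<open>A\<close> is this common set with one point removed.\<close>

lemma card_one_smaller_sets_le:
  "card {A. A \<subseteq> I \<and> card A = s \<and> (\<exists>b \<in> I - A. sm (insert b A) = w)} \<le> s + 1"
    (is "card ?S \<le> _")
proof (cases "?S = {}")
  case False
  then obtain A0 b0 where "A0 \<subseteq> I" "card A0 = s" "b0 \<in> I - A0" "sm (insert b0 A0) = w" by blast
  moreover define D where "D = insert b0 A0"
  ultimately have D: "D \<subseteq> I" "card D = s + 1" "sm D = w"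
    using finite_subset_I[of A0] by auto
  have "?S \<subseteq> (\<lambda>b. D - {b}) ` D"
  proof
    fix A assume "A \<in> ?S"
    then obtain b where A: "A \<subseteq> I" "card A = s" "b \<in> I - A" "sm (insert b A) = w" by blast
    then have "insert b A = D"
      using D finite_subset_I[of A] by (intro sm_inject) auto
    then have "A = D - {b}" "b \<in> D" using A(3) by blast+
    then show "A \<in> (\<lambda>b. D - {b}) ` D" by (rule image_eqI)
  qed
  then have "card ?S \<le> card D" using finite_subset_I[OF D(1)] surj_card_le by blast
  then show ?thesis using D by simp
qed (simp only: card.empty zero_le)

text \<open>
  For \<open>b \<in> B - A\<close> the sum of \<open>insert b A\<close> is determined by \<open>u\<close> and \<open>B - {b}\<close>, so \<open>u\<close> and \<open>B - {b}\<close>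
  leave only \<open>s + 1\<close> choices for \<open>A\<close>.
\<close>

lemma card_clean_near_le:
  assumes r: "r \<in> carrier G" and u: "u \<in> carrier G" and j: "1 \<le> j" "j \<le> s"
  shows "card {A. A \<subseteq> I \<and> card A = s \<and> (\<forall>A'\<subseteq>A. u \<noteq> r \<otimes> sm A') \<and> near j (r \<otimes> sm A) u}
    \<le> s * d ^ (j - 1) * (s + 1)" (is "card ?S \<le> _")
proof -
  let ?T = "\<lambda>w. {A. A \<subseteq> I \<and> card A = s \<and> (\<exists>b \<in> I - A. sm (insert b A) = w)}"
  let ?J = "{B. B \<subseteq> I \<and> card B \<le> j - 1}"
  have "?S \<subseteq> (\<Union>B\<in>?J. ?T (r \<otimes> u \<otimes> sm B))"
  proof
    fix A assume "A \<in> ?S"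
    then obtain B where A: "A \<subseteq> I" "card A = s" "\<forall>A'\<subseteq>A. u \<noteq> r \<otimes> sm A'"
      and B: "B \<subseteq> I" "card B \<le> j" "u = r \<otimes> sm A \<otimes> sm B" by (auto simp: near_def)
    \<comment> \<open>If \<open>B\<close> were contained in \<open>A\<close>, cancellation would
      make \<open>u\<close> the end of a partial sum over \<open>A - B\<close>, which is
      excluded.\<close>
    have "\<not> B \<subseteq> A"
    proof
      assume "B \<subseteq> A"
      then have "(A - B) \<union> (B - A) = A - B" by auto
      then have "u = r \<otimes> sm (A - B)" using B A r sm_mult[of A B] by (simp add: m_assoc)
      then show False using A(3) by blast
    qed
    then obtain b where b: "b \<in> B" "b \<notin> A" by blast
    define B0 where "B0 = B - {b}"
    have B0: "B0 \<subseteq> I" "card B0 \<le> j - 1" using B b finite_subset_I[of B] by (auto simp: B0_def)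
    have eb: "e b \<in> carrier G" using b B e_closed by auto
    have "sm B = sm B0 \<otimes> e b"
      using sm_insert[of B0 b] B b by (auto simp: B0_def insert_absorb)
    then have "u = r \<otimes> sm A \<otimes> (sm B0 \<otimes> e b)" using B by simp
    then have "r \<otimes> u \<otimes> sm B0 = r \<otimes> (r \<otimes> sm A \<otimes> (sm B0 \<otimes> e b)) \<otimes> sm B0" by simp
    also have "\<dots> = (r \<otimes> r) \<otimes> (sm A \<otimes> e b) \<otimes> (sm B0 \<otimes> sm B0)"
      using r A B0 eb by (simp add: m_ac)
    also have "\<dots> = sm A \<otimes> e b" using r A B0 eb by (simp add: mult_self)
    also have "\<dots> = sm (insert b A)" using A b B by (intro sm_insert[symmetric]) auto
    finally have "sm (insert b A) = r \<otimes> u \<otimes> sm B0" by (rule sym)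
    moreover have "b \<in> I - A" using b B(1) by blast
    ultimately have "A \<in> ?T (r \<otimes> u \<otimes> sm B0)" using A(1,2) by blast
    then show "A \<in> (\<Union>B\<in>?J. ?T (r \<otimes> u \<otimes> sm B))" using B0 by blast
  qed
  moreover have finJ: "finite ?J" using finite_I by simp
  moreover have finT: "finite (?T w)" for w using finite_I by simp
  ultimately have "card ?S \<le> card (\<Union>B\<in>?J. ?T (r \<otimes> u \<otimes> sm B))"
    by (intro card_mono) auto
  also have "\<dots> \<le> (\<Sum>B\<in>?J. card (?T (r \<otimes> u \<otimes> sm B)))" using finJ by (rule card_UN_le)
  also have "\<dots> \<le> (\<Sum>B\<in>?J. s + 1)" by (intro sum_mono card_one_smaller_sets_le)
  also have "\<dots> = card ?J * (s + 1)" by simp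
  also have "card ?J * (s + 1) \<le> s * d ^ (j - 1) * (s + 1)"
  proof (rule mult_right_mono)
    have "card ?J \<le> (j - 1 + 1) * d ^ (j - 1)"
      using d_pos finite_I by (intro card_subsets_of_card_at_most_le) auto
    also have "\<dots> \<le> s * d ^ (j - 1)" using j by (intro mult_right_mono) auto
    finally show "card ?J \<le> s * d ^ (j - 1)" .
  qed simp
  finally show ?thesis .
qed

text \<open>
  For \<open>\<epsilon> < 1\<close> the case \<open>j = 1\<close> leaves no cop on or next to \<open>r\<close>. A cop move turns the bound for \<open>j + 1\<close>
  into \<open>\<epsilon> * d ^ j\<close> cops within distance \<open>j\<close>, and one cop there blocks at most \<open>d ^ (s - j)\<close> sets \<open>A\<close>.
\<close>

definition safe :: "real \<Rightarrow> 'a list \<Rightarrow> 'a \<Rightarrow> bool" where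
  "safe \<epsilon> C r \<longleftrightarrow> (\<forall>j\<in>{1..s}. real (ncops j C r) \<le> \<epsilon> * real d ^ (j - 1))"

text \<open>A blocked \<open>A\<close> has a partial sum of some size \<open>l\<close> at a cop, who
  is then within distance \<open>l\<close>. There are at most \<open>\<epsilon> * d ^ l\<close> such
  cops, each blocking at most \<open>d ^ (s - l)\<close> sets, and \<open>l\<close> takes
  \<open>s\<close> values. The exponent \<open>l\<close> in \<open>near\<close> describes the
  position after the cops' move.\<close>

lemma card_unclean_le:
  fixes \<epsilon> :: real
  assumes r: "r \<in> carrier G" and near: "\<And>l. l \<in> {1..s} \<Longrightarrow> real (ncops l C r) \<le> \<epsilon> * real d ^ l"
  shows "real (card {A. A \<subseteq> I \<and> card A = s \<and> (\<exists>A'\<subseteq>A. A' \<noteq> {} \<and> r \<otimes> sm A' \<in> set C)})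
    \<le> s * \<epsilon> * real d ^ s" (is "real (card ?S) \<le> _")
proof -
  let ?R = "\<lambda>l i. {A. A \<subseteq> I \<and> card A = s \<and> (\<exists>A'\<subseteq>A. card A' = l \<and> C ! i = r \<otimes> sm A')}"
  let ?N = "\<lambda>l. {i \<in> {..<length C}. near l r (C ! i)}"
  have finR: "finite (?R l i)" for l i using finite_I by simp
  have "?S \<subseteq> (\<Union>l\<in>{1..s}. \<Union>i\<in>?N l. ?R l i)"
  proof
    fix A assume "A \<in> ?S"
    then obtain A' where A: "A \<subseteq> I" "card A = s" and A': "A' \<subseteq> A" "A' \<noteq> {}" "r \<otimes> sm A' \<in> set C" by blast
    then obtain i where i: "i < length C" "C ! i = r \<otimes> sm A'" by (metis in_set_conv_nth)
    have "card A' \<in> {1..s}"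
      using A A' finite_subset_I[of A] by (auto simp: Suc_le_eq card_gt_0_iff finite_subset intro: card_mono)
    moreover have "near (card A') r (C ! i)" using i A A' unfolding near_def by (intro exI[of _ A']) auto
    moreover have "A \<in> ?R (card A') i" using i(2) A A'(1) by blast
    ultimately show "A \<in> (\<Union>l\<in>{1..s}. \<Union>i\<in>?N l. ?R l i)"
      using i(1) by (intro UN_I[of "card A'"] UN_I[of i]) auto
  qed
  then have "card ?S \<le> card (\<Union>l\<in>{1..s}. \<Union>i\<in>?N l. ?R l i)"
    using finR by (intro card_mono) auto
  also have "\<dots> \<le> (\<Sum>l\<in>{1..s}. card (\<Union>i\<in>?N l. ?R l i))" by (intro card_UN_le) simp
  also have "\<dots> \<le> (\<Sum>l\<in>{1..s}. \<Sum>i\<in>?N l. card (?R l i))" by (intro sum_mono card_UN_le) simp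
  also have "\<dots> \<le> (\<Sum>l\<in>{1..s}. \<Sum>i\<in>?N l. d ^ (s - l))"
    using r by (intro sum_mono card_supersets_of_rep_le) auto
  also have "\<dots> = (\<Sum>l\<in>{1..s}. ncops l C r * d ^ (s - l))" by (simp add: ncops_def)
  finally have "real (card ?S) \<le> real (\<Sum>l\<in>{1..s}. ncops l C r * d ^ (s - l))"
    by (rule of_nat_mono)
  also have "\<dots> = (\<Sum>l\<in>{1..s}. real (ncops l C r) * real d ^ (s - l))" by simp
  also have "\<dots> \<le> (\<Sum>l\<in>{1..s}. \<epsilon> * real d ^ s)"
  proof (rule sum_mono)
    fix l assume l: "l \<in> {1..s}"
    have "real (ncops l C r) * real d ^ (s - l) \<le> \<epsilon> * real d ^ l * real d ^ (s - l)"
      using near[OF l] by (intro mult_right_mono) auto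
    also have "\<dots> = \<epsilon> * real d ^ s" using l by (simp flip: power_add)
    finally show "real (ncops l C r) * real d ^ (s - l) \<le> \<epsilon> * real d ^ s" .
  qed
  finally show ?thesis by simp
qed

text \<open>Each cop is within distance \<open>j\<close> of the end vertex for at most
  \<open>s * (s + 1) * d ^ (j - 1)\<close> sets in \<open>S\<close>. The threshold has the same
  power of \<open>d\<close>, so after double counting the bound no longer depends on
  \<open>j\<close>.\<close>

lemma card_clean_unsafe_le:
  fixes c \<epsilon> :: real
  assumes r: "r \<in> carrier G" and C: "set C \<subseteq> carrier G" and len: "real (length C) \<le> c * real d ^ s"
    and \<epsilon>: "\<epsilon> > 0" and j: "j \<in> {1..s}"
    and S: "S \<subseteq> {A. A \<subseteq> I \<and> card A = s \<and> (\<forall>A'\<subseteq>A. r \<otimes> sm A' \<notin> set C)}"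
  shows "real (card {A \<in> S. \<epsilon> * real d ^ (j - 1) < real (ncops j C (r \<otimes> sm A))})
    \<le> s * (s + 1) * c / \<epsilon> * real d ^ s" (is "real (card ?B) \<le> _")
proof -
  have "finite {A. A \<subseteq> I \<and> card A = s \<and> (\<forall>A'\<subseteq>A. r \<otimes> sm A' \<notin> set C)}" using finite_I by simp
  then have finS: "finite S" using S finite_subset by blast
  have "card {A \<in> S. near j (r \<otimes> sm A) (C ! i)} \<le> s * d ^ (j - 1) * (s + 1)"
    if "i \<in> {..<length C}" for i
  proof -
    have Ci: "C ! i \<in> set C" using that by simp
    have "{A \<in> S. near j (r \<otimes> sm A) (C ! i)}
        \<subseteq> {A. A \<subseteq> I \<and> card A = s \<and> (\<forall>A'\<subseteq>A. C ! i \<noteq> r \<otimes> sm A') \<and> near j (r \<otimes> sm A) (C ! i)}"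
      using S Ci by force
    then have "card {A \<in> S. near j (r \<otimes> sm A) (C ! i)}
        \<le> card {A. A \<subseteq> I \<and> card A = s \<and> (\<forall>A'\<subseteq>A. C ! i \<noteq> r \<otimes> sm A') \<and> near j (r \<otimes> sm A) (C ! i)}"
      using finite_I by (intro card_mono) auto
    also have "\<dots> \<le> s * d ^ (j - 1) * (s + 1)"
      using r C Ci j by (intro card_clean_near_le) auto
    finally show ?thesis .
  qed
  then have "\<epsilon> * real d ^ (j - 1) * real (card ?B) \<le> real (card {..<length C} * (s * d ^ (j - 1) * (s + 1)))"
    unfolding ncops_def using finS \<epsilon> by (intro markov_inequality_card) auto
  also have "\<dots> = real (length C) * (s * (s + 1)) * real d ^ (j - 1)" by (simp add: algebra_simps)
  finally have "\<epsilon> * real (card ?B) \<le> real (length C) * (s * (s + 1))"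
    using d_pos by (simp add: mult.assoc mult.left_commute[of \<epsilon>] mult.commute[of _ "real d ^ (j - 1)"])
  also have "\<dots> \<le> c * real d ^ s * (s * (s + 1))" using len by (intro mult_right_mono) auto
  finally show ?thesis using \<epsilon> by (simp add: field_simps)
qed

text \<open>There are at least \<open>(d / s) ^ s\<close> sets of \<open>s\<close> generators. The
  two summands in \<open>small\<close> bound, in units of \<open>d ^ s\<close>, the blocked sets and
  the unblocked sets whose end vertex violates the invariant at one of the \<open>s\<close> radii.
  Some set is left over.\<close>

lemma robber_escapes:
  fixes c \<epsilon> :: real
  assumes r: "r \<in> carrier G" "r \<notin> set C" and C: "set C \<subseteq> carrier G"
    and len: "real (length C) \<le> c * real d ^ s" and \<epsilon>: "\<epsilon> > 0"
    and near: "\<And>l. l \<in> {1..s} \<Longrightarrow> real (ncops l C r) \<le> \<epsilon> * real d ^ l"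
    and small: "s * \<epsilon> + s * (s * (s + 1) * c / \<epsilon>) < 1 / real s ^ s"
    and \<sigma>: "enat s \<le> \<sigma>"
  obtains r' where "r' \<in> carrier G" "robber_move \<Gamma> \<sigma> C r r'" "safe \<epsilon> C r'"
proof -
  let ?U = "{A. A \<subseteq> I \<and> card A = s \<and> (\<exists>A'\<subseteq>A. A' \<noteq> {} \<and> r \<otimes> sm A' \<in> set C)}"
  let ?S = "{A. A \<subseteq> I \<and> card A = s \<and> (\<forall>A'\<subseteq>A. r \<otimes> sm A' \<notin> set C)}"
  let ?B = "\<lambda>j. {A \<in> ?S. \<epsilon> * real d ^ (j - 1) < real (ncops j C (r \<otimes> sm A))}"
  have "\<exists>A \<in> ?S. safe \<epsilon> C (r \<otimes> sm A)"
  proof (rule ccontr)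
    assume neg: "\<not> (\<exists>A \<in> ?S. safe \<epsilon> C (r \<otimes> sm A))"
    have "{A. A \<subseteq> I \<and> card A = s} \<subseteq> ?U \<union> (\<Union>j\<in>{1..s}. ?B j)"
    proof
      fix A assume "A \<in> {A. A \<subseteq> I \<and> card A = s}"
      then have A: "A \<subseteq> I" "card A = s" by auto
      show "A \<in> ?U \<union> (\<Union>j\<in>{1..s}. ?B j)"
      proof (cases "A \<in> ?U")
        case False
        then have "r \<otimes> sm A' \<notin> set C" if "A' \<subseteq> A" for A'
          using A that r by (cases "A' = {}") auto
        then have "A \<in> ?S" using A by blast
        moreover from this have "\<not> safe \<epsilon> C (r \<otimes> sm A)" using neg by blast
        ultimately have "\<exists>j\<in>{1..s}. A \<in> ?B j" unfolding safe_def by (auto simp: not_le)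
        then show ?thesis by blast
      qed simp
    qed
    then have "card {A. A \<subseteq> I \<and> card A = s} \<le> card (?U \<union> (\<Union>j\<in>{1..s}. ?B j))"
      using finite_I by (intro card_mono) auto
    also have "\<dots> \<le> card ?U + card (\<Union>j\<in>{1..s}. ?B j)" by (rule card_Un_le)
    also have "card (\<Union>j\<in>{1..s}. ?B j) \<le> (\<Sum>j\<in>{1..s}. card (?B j))" by (intro card_UN_le) simp
    finally have "real (d choose s) \<le> real (card ?U) + (\<Sum>j\<in>{1..s}. real (card (?B j)))"
      using finite_I by (simp add: n_subsets flip: of_nat_sum of_nat_add)
    also have "\<dots> \<le> s * \<epsilon> * real d ^ s + (\<Sum>j\<in>{1..s}. s * (s + 1) * c / \<epsilon> * real d ^ s)"
      using r C len \<epsilon> near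
      by (intro add_mono sum_mono card_unclean_le[OF r(1) near] card_clean_unsafe_le[OF r(1) C len \<epsilon>]) auto
    also have "\<dots> = (s * \<epsilon> + s * (s * (s + 1) * c / \<epsilon>)) * real d ^ s" by (simp add: algebra_simps)
    also have "\<dots> < 1 / real s ^ s * real d ^ s"
      using small d_pos by (intro mult_strict_right_mono) auto
    also have "\<dots> = (real d / real s) ^ s" by (simp add: power_divide)
    also have "\<dots> \<le> real (d choose s)" using binomial_ge_n_over_k_pow_k[OF s_le, where ?'a = real] by simp
    finally show False by simp
  qed
  then obtain A where A: "A \<subseteq> I" "card A = s" "\<forall>A'\<subseteq>A. r \<otimes> sm A' \<notin> set C" "safe \<epsilon> C (r \<otimes> sm A)"
    by blast
  then have "robber_move \<Gamma> \<sigma> C r (r \<otimes> sm A)" using r \<sigma> by (intro robber_move_along_set) auto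
  then show ?thesis using that[of "r \<otimes> sm A"] r A by simp
qed

section \<open>Survival from a safe position, and the choice of the initial vertex\<close>

lemma not_safe_if_near:
  assumes "\<epsilon> < 1" "i < length C" "near 1 r (C ! i)"
  shows "\<not> safe \<epsilon> C r"
proof
  assume "safe \<epsilon> C r"
  then have "real (ncops 1 C r) \<le> \<epsilon> * real d ^ (1 - 1)"
    unfolding safe_def by (rule bspec) (use s_pos in simp)
  then show False using ncops_pos[OF assms(2,3)] assms(1) by simp
qed

text \<open>Induction on the forced win: no cop can capture in one move from a safe position, and
  after any other cop move the robber restores the invariant.\<close>

lemma not_cops_win_if_safe:
  fixes c \<epsilon> :: real
  assumes "cops_win \<Gamma> \<sigma> C r"
    and "r \<in> carrier G" "set C \<subseteq> carrier G" "real (length C) \<le> c * real d ^ s"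
    and \<epsilon>: "0 < \<epsilon>" "\<epsilon> < 1" and c: "c \<le> \<epsilon>"
    and small: "s * \<epsilon> + s * (s * (s + 1) * c / \<epsilon>) < 1 / real s ^ s"
    and \<sigma>: "enat s \<le> \<sigma>"
  shows "\<not> safe \<epsilon> C r"
  using assms(1-4)
proof (induction rule: cops_win.induct)
  case (captured r C)
  then show ?case using not_safe_if_near \<epsilon>(2) near_self by (metis in_set_conv_nth)
next
  case (capture C C' r)
  then obtain i where i: "i < length C'" "C' ! i = r" by (metis in_set_conv_nth)
  \<comment> \<open>The capturing cop was within distance 1 before its move, which
    \<open>safe\<close> forbids for \<open>\<epsilon> < 1\<close>.\<close>
  then have "i < length C" "C ! i = r \<or> C ! i \<rightarrow>\<^bsub>\<Gamma>\<^esub> r"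
    using capture(1) by (auto simp: cops_move_def list_all2_conv_all_nth)
  then show ?case
    using not_safe_if_near[OF \<epsilon>(2)] near_step[OF capture.prems(1) near_self[OF capture.prems(1)], of "C ! i" 0] by simp
next
  case (round C C' r)
  show ?case
  proof
    assume safe: "safe \<epsilon> C r"
    have C': "set C' \<subseteq> carrier G" using cops_move_closed round by blast
    have len: "length C' = length C" using round(1) by (auto simp: cops_move_def list_all2_lengthD)
    have near: "real (ncops l C' r) \<le> \<epsilon> * real d ^ l" if l: "l \<in> {1..s}" for l
    \<comment> \<open>For \<open>l = s\<close> the invariant would be needed at radius
      \<open>s + 1\<close>, where it says nothing; the total number of cops is small enough, since
      \<open>c \<le> \<epsilon>\<close>.\<close>
    proof (cases "l = s")
      case True
      have "real (ncops l C' r) \<le> real (card {..<length C'})"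
        unfolding ncops_def by (intro of_nat_mono card_mono) auto
      also have "\<dots> \<le> c * real d ^ s" using round.prems len by simp
      also have "\<dots> \<le> \<epsilon> * real d ^ l" using c True by (simp add: mult_right_mono)
      finally show ?thesis .
    next
      case False
      have "real (ncops l C' r) \<le> real (ncops (Suc l) C r)"
        using ncops_cops_move round by simp
      also have "\<dots> \<le> \<epsilon> * real d ^ l" using safe l False by (force simp: safe_def)
      finally show ?thesis .
    qed
    obtain r' where "r' \<in> carrier G" "robber_move \<Gamma> \<sigma> C' r r'" "safe \<epsilon> C' r'"
    proof (rule robber_escapes[OF round.prems(1) round.hyps(2) C' _ \<epsilon>(1) near small \<sigma>])
      show "real (length C') \<le> c * real d ^ s" using len round.prems by simp
    qed auto
    then show False using round.IH C' len round.prems by auto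
  qed
qed

text \<open>Averaging over all vertices: each cop is within distance \<open>j\<close> of at most
  \<open>(s + 1) * d ^ j\<close> of them, so few vertices violate the bound at any one radius,
  compared with the at least \<open>d ^ (s + 1)\<close> vertices available.\<close>

lemma ex_safe:
  fixes c \<epsilon> :: real
  assumes C: "set C \<subseteq> carrier G" and len: "real (length C) \<le> c * real d ^ s" and \<epsilon>: "\<epsilon> > 0"
    and card: "d ^ (s + 1) \<le> card (carrier G)" and small: "s * ((s + 1) * c / \<epsilon>) < 1"
  obtains r where "r \<in> carrier G" "safe \<epsilon> C r"
proof -
  let ?B = "\<lambda>j. {r \<in> carrier G. \<epsilon> * real d ^ (j - 1) < real (ncops j C r)}"
  have B: "real (card (?B j)) \<le> (s + 1) * c / \<epsilon> * real d ^ (s + 1)" if j: "j \<in> {1..s}" for j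
  proof -
    have "card {r \<in> carrier G. near j r (C ! i)} \<le> (s + 1) * d ^ j" if i: "i \<in> {..<length C}" for i
    proof -
      have Ci: "C ! i \<in> carrier G" using i C by auto
      have "{r \<in> carrier G. near j r (C ! i)} \<subseteq> (\<lambda>B. C ! i \<otimes> sm B) ` {B. B \<subseteq> I \<and> card B \<le> j}"
      proof
        fix r assume "r \<in> {r \<in> carrier G. near j r (C ! i)}"
        then obtain B where "r \<in> carrier G" "B \<subseteq> I" "card B \<le> j" "C ! i = r \<otimes> sm B"
          by (auto simp: near_def)
        moreover from this have "r = C ! i \<otimes> sm B" by (simp add: mult_cancel_self)
        ultimately show "r \<in> (\<lambda>B. C ! i \<otimes> sm B) ` {B. B \<subseteq> I \<and> card B \<le> j}" by blast
      qed
      then have "card {r \<in> carrier G. near j r (C ! i)} \<le> card {B. B \<subseteq> I \<and> card B \<le> j}"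
        using finite_I by (intro surj_card_le) auto
      also have "\<dots> \<le> (j + 1) * d ^ j"
        using finite_I d_pos by (intro card_subsets_of_card_at_most_le) auto
      also have "\<dots> \<le> (s + 1) * d ^ j" using j by (intro mult_right_mono) auto
      finally show ?thesis .
    qed
    then have "\<epsilon> * real d ^ (j - 1) * real (card (?B j)) \<le> real (card {..<length C} * ((s + 1) * d ^ j))"
      unfolding ncops_def using finite_G \<epsilon> by (intro markov_inequality_card) auto
    also have "\<dots> = real (length C) * (s + 1) * real d * real d ^ (j - 1)"
      using j by (cases j) (auto simp: algebra_simps)
    finally have "\<epsilon> * real (card (?B j)) \<le> real (length C) * (s + 1) * real d"
      using d_pos by (simp add: mult.assoc mult.left_commute[of \<epsilon>] mult.commute[of _ "real d ^ (j - 1)"])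
    also have "\<dots> \<le> c * real d ^ s * (s + 1) * real d" using len by (intro mult_right_mono) auto
    finally show ?thesis using \<epsilon> by (simp add: field_simps)
  qed
  have "\<exists>r\<in>carrier G. safe \<epsilon> C r"
  proof (rule ccontr)
    assume "\<not> (\<exists>r\<in>carrier G. safe \<epsilon> C r)"
    then have "carrier G \<subseteq> (\<Union>j\<in>{1..s}. ?B j)" by (auto simp: safe_def not_le)
    then have "card (carrier G) \<le> card (\<Union>j\<in>{1..s}. ?B j)"
      using finite_G by (intro card_mono) auto
    also have "\<dots> \<le> (\<Sum>j\<in>{1..s}. card (?B j))" by (intro card_UN_le) simp
    finally have "real (card (carrier G)) \<le> (\<Sum>j\<in>{1..s}. real (card (?B j)))"
      by (simp flip: of_nat_sum)
    also have "\<dots> \<le> (\<Sum>j\<in>{1..s}. (s + 1) * c / \<epsilon> * real d ^ (s + 1))" by (intro sum_mono B)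
    also have "\<dots> = s * ((s + 1) * c / \<epsilon>) * real d ^ (s + 1)" by simp
    also have "\<dots> < 1 * real d ^ (s + 1)"
      using small d_pos by (intro mult_strict_right_mono) auto
    also have "\<dots> \<le> real (card (carrier G))" using card by (simp flip: of_nat_power of_nat_mult)
    finally show False by simp
  qed
  then show ?thesis using that by blast
qed

text \<open>With too few cops a safe initial vertex exists for every placement, and from there no
  win can be forced.\<close>

theorem cops_suffice_lower_bound:
  assumes "d ^ (s + 1) \<le> card (carrier G)" and \<sigma>: "enat s \<le> \<sigma>" and m: "cops_suffice \<Gamma> \<sigma> m"
  shows "real d ^ s / (16 * real s ^ (2 * s + 3) * (s + 1)) < m"
proof (rule ccontr)
  \<comment> \<open>The constants are chosen so that both summands of \<open>small\<close> equal
    \<open>1 / (4 * s ^ s)\<close>; together they are half of the permitted amount.\<close>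
  define \<epsilon> where "\<epsilon> = 1 / (4 * real s ^ (s + 1))"
  define c where "c = 1 / (16 * real s ^ (2 * s + 3) * (s + 1))"
  assume "\<not> real d ^ s / (16 * real s ^ (2 * s + 3) * (s + 1)) < m"
  then have m_le: "real m \<le> c * real d ^ s" by (simp add: c_def)
  have s1: "real s \<ge> 1" using s_pos by simp
  then have p1: "real s ^ i \<ge> 1" for i by simp
  have \<epsilon>: "0 < \<epsilon>" "\<epsilon> < 1" using p1[of "s + 1"] s_pos by (auto simp: \<epsilon>_def field_simps)
  have s\<epsilon>: "s * \<epsilon> = 1 / (4 * real s ^ s)" using s_pos by (simp add: \<epsilon>_def)
  have "2 * s + 3 = (s + 1) + Suc (s + 1)" by simp
  then have "real s ^ (2 * s + 3) = real s ^ (s + 1) * (real s * real s ^ (s + 1))"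
    by (simp only: power_add power_Suc)
  then have "c = \<epsilon> * (1 / (4 * (real s * real s ^ (s + 1)) * (s + 1)))"
    by (simp add: c_def \<epsilon>_def mult_ac)
  then have c\<epsilon>: "c / \<epsilon> = 1 / (4 * (real s * real s ^ (s + 1)) * (s + 1))"
    using \<epsilon> by simp
  have cancel: "x * k * (1 / (4 * (x * y) * k)) = 1 / (4 * y)" if "x > 0" "k > 0" for x y k :: real
    using that by simp
  have "s * (s + 1) * c / \<epsilon> = real s * real (s + 1) * (c / \<epsilon>)" by (simp add: algebra_simps add_divide_distrib)
  also have "\<dots> = 1 / (4 * real s ^ (s + 1))"
    unfolding c\<epsilon> using s_pos by (intro cancel) auto
  finally have sc: "s * (s + 1) * c / \<epsilon> = 1 / (4 * real s ^ (s + 1))" .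
  then have "s * (s * (s + 1) * c / \<epsilon>) = 1 / (4 * real s ^ s)"
    using s_pos by simp
  moreover have "1 / (4 * real s ^ s) + 1 / (4 * real s ^ s) < 1 / real s ^ s"
  proof -
    have "1 / (4 * real s ^ s) + 1 / (4 * real s ^ s) = (1 / real s ^ s) / 2" by simp
    moreover have "1 / real s ^ s > 0" using s_pos by simp
    ultimately show ?thesis by linarith
  qed
  ultimately have small: "s * \<epsilon> + s * (s * (s + 1) * c / \<epsilon>) < 1 / real s ^ s"
    by (simp only: s\<epsilon>)
  have sc1: "s * (s + 1) * c / \<epsilon> < 1" using sc \<epsilon>(2) unfolding \<epsilon>_def by linarith
  then have small': "s * ((s + 1) * c / \<epsilon>) < 1" by (simp add: algebra_simps add_divide_distrib)
  \<comment> \<open>Because \<open>s * (s + 1)\<close> is at least 1, \<open>sc1\<close> also yields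
    \<open>c \<le> \<epsilon>\<close>.\<close>
  have "1 * 1 \<le> real s * real (s + 1)" using s1 by (intro mult_mono) auto
  then have "1 * (c / \<epsilon>) \<le> real s * real (s + 1) * (c / \<epsilon>)"
    using c\<epsilon> by (intro mult_right_mono) auto
  also have "\<dots> = s * (s + 1) * c / \<epsilon>" by (simp add: algebra_simps add_divide_distrib)
  also have "\<dots> < 1" by (rule sc1)
  finally have "c \<le> \<epsilon>" using \<epsilon> by (simp add: field_simps)
  obtain C where C: "length C = m" "set C \<subseteq> carrier G" "\<And>r. r \<in> carrier G \<Longrightarrow> cops_win \<Gamma> \<sigma> C r"
    using m by (auto simp: cops_suffice_def)
  obtain r where "r \<in> carrier G" "safe \<epsilon> C r"
    using ex_safe[OF C(2) _ \<epsilon>(1) assms(1) small'] m_le C(1) by auto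
  then show False
    using not_cops_win_if_safe[OF C(3) _ C(2) _ \<epsilon> \<open>c \<le> \<epsilon>\<close> small \<sigma>] m_le C(1) by auto
qed

end

section \<open>The Alon--Mehrabian graphs\<close>

lemma carrier_AM_group:
  "carrier (AM_group F s) = {0..<2} \<times> (\<Pi>\<^sub>E i\<in>{..s}. carrier F)"
  by (simp add: AM_group_def carrier_integer_mod_group)

lemma mult_AM_group:
  "x \<otimes>\<^bsub>AM_group F s\<^esub> y = ((fst x + fst y) mod 2, \<lambda>i\<in>{..s}. snd x i \<oplus>\<^bsub>F\<^esub> snd y i)"
  by (simp add: AM_group_def mult_DirProd')

lemma one_AM_group:
  "\<one>\<^bsub>AM_group F s\<^esub> = (0, \<lambda>i\<in>{..s}. \<zero>\<^bsub>F\<^esub>)"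
  by (simp add: AM_group_def)

lemma card_AM_group:
  "card (carrier (AM_group F s)) = 2 * card (carrier F) ^ (s + 1)"
  by (simp add: carrier_AM_group card_cartesian_product card_PiE)

locale binary_field = field R for R :: "'a ring" (structure) +
  fixes k :: nat
  assumes card_carrier: "card (carrier R) = 2 ^ k"
begin

lemma char2: "x \<in> carrier R \<Longrightarrow> x \<oplus> x = \<zero>"
  using char_2_if_card_power_2[OF card_carrier] .

lemma finite_carrier: "finite (carrier R)"
  using card_carrier by (metis card.infinite power_eq_0_iff zero_neq_numeral)

lemma elementary_abelian_AM_group:
  "elementary_abelian_2_group (AM_group R s)"
proof -
  have "group (AM_group R s)"
    unfolding AM_group_def by (intro DirProd_group product_group group_integer_mod_group a_group)
  then have "comm_group (AM_group R s)"
  proof (rule group.group_comm_groupI)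
    fix x y assume "x \<in> carrier (AM_group R s)" "y \<in> carrier (AM_group R s)"
    then show "x \<otimes>\<^bsub>AM_group R s\<^esub> y = y \<otimes>\<^bsub>AM_group R s\<^esub> x"
      by (auto simp: mult_AM_group carrier_AM_group add.commute PiE_iff intro!: restrict_ext a_comm)
  qed
  moreover have "x \<otimes>\<^bsub>AM_group R s\<^esub> x = \<one>\<^bsub>AM_group R s\<^esub>" if "x \<in> carrier (AM_group R s)" for x
    using that char2 by (auto simp: mult_AM_group one_AM_group carrier_AM_group PiE_iff intro!: restrict_ext)
  ultimately show ?thesis
    by (simp add: elementary_abelian_2_group_def elementary_abelian_2_group_axioms_def)
qed

lemma AM_elt_closed: "AM_elt R s \<in> carrier R \<rightarrow> carrier (AM_group R s)"
  by (auto simp: AM_elt_def carrier_AM_group)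

text \<open>Coordinate 0 is the first power, from which \<open>x\<close> can be read off.\<close>

lemma inj_on_AM_elt: "inj_on (AM_elt R s) (carrier R)"
proof (rule inj_onI)
  fix x y assume xy: "x \<in> carrier R" "y \<in> carrier R" "AM_elt R s x = AM_elt R s y"
  then have "snd (AM_elt R s x) 0 = snd (AM_elt R s y) 0" by simp
  then show "x = y" using xy(1,2) by (simp add: AM_elt_def)
qed

text \<open>Translates sums of generators into the data of the power sum argument: the parity of
  \<open>D\<close> and its odd power sums.\<close>

lemma finprod_AM_elt:
  assumes "finite D" "D \<subseteq> carrier R"
  shows "finprod (AM_group R s) (AM_elt R s) D
    = (int (card D) mod 2, \<lambda>j\<in>{..s}. \<Oplus>x\<in>D. x [^] (2 * j + 1))"
  using assms
proof (induction D)
  interpret elementary_abelian_2_group "AM_group R s"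
    using elementary_abelian_AM_group .
  case empty
  then show ?case by (simp add: one_AM_group restrict_def)
next
  interpret elementary_abelian_2_group "AM_group R s"
    using elementary_abelian_AM_group .
  case (insert a D)
  then have D: "D \<subseteq> carrier R" "a \<in> carrier R" by auto
  have "finprod (AM_group R s) (AM_elt R s) (insert a D)
      = AM_elt R s a \<otimes>\<^bsub>AM_group R s\<^esub> finprod (AM_group R s) (AM_elt R s) D"
    using insert.hyps D AM_elt_closed by (intro finprod_insert) auto
  also have "\<dots> = ((1 + int (card D) mod 2) mod 2,
      \<lambda>j\<in>{..s}. a [^] (2 * j + 1) \<oplus> (\<Oplus>x\<in>D. x [^] (2 * j + 1)))"
    unfolding insert.IH[OF D(1)] unfolding AM_elt_def mult_AM_group by (auto intro!: restrict_ext)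
  also have "(1 + int (card D) mod 2) mod 2 = int (card (insert a D)) mod 2"
    using insert.hyps by (simp add: mod_add_right_eq add.commute)
  also have "(\<lambda>j\<in>{..s}. a [^] (2 * j + 1) \<oplus> (\<Oplus>x\<in>D. x [^] (2 * j + 1)))
      = (\<lambda>j\<in>{..s}. \<Oplus>x\<in>insert a D. x [^] (2 * j + 1))"
    using insert.hyps D by (intro restrict_ext finsum_insert[symmetric]) auto
  finally show ?case .
qed

text \<open>The BCH argument: a trivial sum means even cardinality and vanishing odd power sums up
  to \<open>2 * s + 1\<close>, hence vanishing power sums for all exponents up to
  \<open>2 * s + 2\<close>. A set of at most \<open>2 * s + 2\<close> points with this property is
  empty.\<close>

lemma independent_AM_elt:
  assumes s: "1 \<le> s" "s \<le> 2 ^ k"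
  shows "independent_generators (AM_group R s) (carrier R) (AM_elt R s) s"
proof -
  interpret elementary_abelian_2_group "AM_group R s"
    using elementary_abelian_AM_group .
  have "D = {}" if D: "D \<subseteq> carrier R" "card D \<le> 2 * s + 2"
    and one: "finprod (AM_group R s) (AM_elt R s) D = \<one>\<^bsub>AM_group R s\<^esub>" for D
  proof (rule empty_if_power_sums_zero[where n = "2 * s + 2"])
    show finD: "finite D" using D finite_carrier finite_subset by blast
    have eq: "(int (card D) mod 2, \<lambda>j\<in>{..s}. \<Oplus>x\<in>D. x [^] (2 * j + 1)) = (0, \<lambda>i\<in>{..s}. \<zero>)"
      using one finprod_AM_elt[OF finD D(1), of s] by (simp add: one_AM_group)
    have "(\<Oplus>x\<in>D. x [^] (2 * j + 1)) = \<zero>" if "j \<le> s" for j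
      using fun_cong[OF arg_cong[OF eq, of snd], of j] that by simp
    moreover have "even (card D)"
    proof -
      have "int (card D) mod 2 = 0" using arg_cong[OF eq, of fst] by simp
      then show ?thesis by presburger
    qed
    ultimately show "(\<Oplus>x\<in>D. x [^] p) = \<zero>" if "p \<le> 2 * s + 2" for p :: nat
      using power_sums_zero_if_odd_power_sums_zero[OF char2 D(1) finD] that by blast
  qed (use D in auto)
  moreover have "finite (carrier (AM_group R s))"
    using finite_carrier by (auto simp: carrier_AM_group intro: finite_PiE)
  ultimately show ?thesis
    using finite_carrier AM_elt_closed s card_carrier by unfold_locales auto
qed

text \<open>
  The vertices whose coordinate 0 vanishes dominate the graph: the neighbour of \<open>r\<close> in direction
  \<open>AM_elt R s (snd r 0)\<close> is one of them. So these cops capture the robber at their first move.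
\<close>

lemma cops_suffice_AM_graph:
  "cops_suffice (AM_graph R s) \<tau> (2 * (2 ^ k) ^ s)"
proof -
  interpret A: elementary_abelian_2_group "AM_group R s"
    using elementary_abelian_AM_group .
  define D where "D = {0..<2::int} \<times> (\<Pi>\<^sub>E i\<in>{..s}. if i = 0 then {\<zero>} else carrier R)"
  have "finite D" using finite_carrier by (auto simp: D_def intro!: finite_PiE)
  then obtain C where C: "set C = D" "distinct C" using finite_distinct_list by blast
  have "card D = 2 * (\<Prod>i\<le>s. card (if i = 0 then {\<zero>} else carrier R))"
    by (simp add: D_def card_cartesian_product card_PiE)
  \<comment> \<open>Coordinate 0 contributes a factor one, and \<open>s\<close> free coordinates
    remain.\<close>
  also have "(\<Prod>i\<le>s. card (if i = 0 then {\<zero>} else carrier R)) = (2 ^ k) ^ s"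
    by (subst prod.atMost_shift) (simp add: card_carrier)
  finally have len: "length C = 2 * (2 ^ k) ^ s" using C distinct_card by fastforce
  have Dsub: "D \<subseteq> carrier (AM_group R s)"
  proof -
    have "(\<Pi>\<^sub>E i\<in>{..s}. if i = 0 then {\<zero>} else carrier R) \<subseteq> (\<Pi>\<^sub>E i\<in>{..s}. carrier R)"
      by (intro PiE_mono) auto
    then show ?thesis by (auto simp: D_def carrier_AM_group)
  qed
  have "cops_win (AM_graph R s) \<tau> C r" if r: "r \<in> carrier (AM_group R s)" for r
  proof -
    define x where "x = snd r 0"
    define v where "v = r \<otimes>\<^bsub>AM_group R s\<^esub> AM_elt R s x"
    have x: "x \<in> carrier R" using r by (auto simp: x_def carrier_AM_group PiE_iff)
    have e: "AM_elt R s x \<in> carrier (AM_group R s)" using AM_elt_closed x by blast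
    have vc: "v \<in> carrier (AM_group R s)" using r e by (simp add: v_def)
    have "snd v 0 = \<zero>" using x char2 by (simp add: v_def mult_AM_group AM_elt_def flip: x_def)
    then have "v \<in> D" using vc by (auto simp: D_def carrier_AM_group PiE_iff)
    then obtain i where i: "i < length C" "C ! i = v" using C by (metis in_set_conv_nth)
    have "r = v \<otimes>\<^bsub>AM_group R s\<^esub> AM_elt R s x" using r e by (simp add: v_def A.mult_cancel_self)
    then have "v \<rightarrow>\<^bsub>AM_graph R s\<^esub> r" using vc x unfolding AM_graph_def dominates_Cay_iff by blast
    then have "cops_move (AM_graph R s) C (C[i := r])"
      using i by (auto simp: cops_move_def list_all2_conv_all_nth nth_list_update)
    moreover have "r \<in> set (C[i := r])" using i by (simp add: set_update_memI)
    ultimately show ?thesis by (rule cops_win.capture)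
  qed
  then show ?thesis using C Dsub len by (auto simp: cops_suffice_def AM_graph_def Cay_def)
qed

text \<open>The dominating cops win before the robber can move, and the robber's strategy uses only
  paths of length \<open>s\<close>. So the same bounds serve every speed from \<open>s\<close> on,
  including \<open>\<infinity>\<close>.\<close>

lemma cop_number_AM_graph_bounds:
  assumes s: "1 \<le> s" "s \<le> 2 ^ k" and \<tau>: "enat s \<le> \<tau>"
  shows "(2 ^ k) ^ s / (16 * real s ^ (2 * s + 3) * (s + 1)) \<le> cop_number (AM_graph R s) \<tau>"
    and "cop_number (AM_graph R s) \<tau> \<le> 2 * (2 ^ k) ^ s"
proof -
  interpret independent_generators "AM_group R s" "carrier R" "AM_elt R s" s
    using independent_AM_elt[OF s] .
  have suff: "cops_suffice (AM_graph R s) \<tau> (2 * (2 ^ k) ^ s)"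
    by (rule cops_suffice_AM_graph)
  then show "cop_number (AM_graph R s) \<tau> \<le> 2 * (2 ^ k) ^ s"
    unfolding cop_number_def by (rule Least_le)
  \<comment> \<open>The explicit placement \<open>suff\<close> shows that the minimum in
    \<open>cop_number\<close> is attained.\<close>
  have "cops_suffice (AM_graph R s) \<tau> (cop_number (AM_graph R s) \<tau>)"
    unfolding cop_number_def using suff by (rule LeastI)
  then show "(2 ^ k) ^ s / (16 * real s ^ (2 * s + 3) * (s + 1)) \<le> cop_number (AM_graph R s) \<tau>"
    using cops_suffice_lower_bound[OF _ \<tau>, of "cop_number (AM_graph R s) \<tau>"] card_carrier
    by (simp add: card_AM_group AM_graph_def)
qed

section \<open>Degree and isomorphism type\<close>

lemma out_degree_AM_graph:
  assumes "v \<in> verts (AM_graph R s)"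
  shows "out_degree (AM_graph R s) v = 2 ^ k"
proof -
  interpret A: elementary_abelian_2_group "AM_group R s"
    using elementary_abelian_AM_group .
  have v: "v \<in> carrier (AM_group R s)" using assms(1) by (simp add: AM_graph_def Cay_def)
  have "out_arcs (AM_graph R s) v = (\<lambda>x. (v, v \<otimes>\<^bsub>AM_group R s\<^esub> AM_elt R s x)) ` carrier R"
    using v by (simp add: AM_graph_def out_arcs_Cay image_image)
  moreover have "inj_on (\<lambda>x. (v, v \<otimes>\<^bsub>AM_group R s\<^esub> AM_elt R s x)) (carrier R)"
  proof (rule inj_onI)
    fix x y assume xy: "x \<in> carrier R" "y \<in> carrier R"
      and "(v, v \<otimes>\<^bsub>AM_group R s\<^esub> AM_elt R s x) = (v, v \<otimes>\<^bsub>AM_group R s\<^esub> AM_elt R s y)"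
    then have "AM_elt R s x = AM_elt R s y"
      using v AM_elt_closed[of s] by (auto simp: Pi_iff)
    then show "x = y" using xy inj_on_AM_elt by (auto dest: inj_onD)
  qed
  ultimately show ?thesis by (simp add: out_degree_def card_image card_carrier)
qed

lemma AM_group_iso:
  "AM_group R s \<cong> product_group {..<1 + k * (s + 1)} (\<lambda>_. integer_mod_group 2)"
proof -
  interpret A: elementary_abelian_2_group "AM_group R s"
    using elementary_abelian_AM_group .
  have "order (AM_group R s) = 2 ^ (1 + k * (s + 1))"
    by (simp only: order_def card_AM_group card_carrier power_add power_one_right power_mult)
  then show ?thesis by (rule A.iso_product_group_integer_mod_group_2)
qed

end

text \<open>For order \<open>2 * d ^ (s + 1)\<close> the exponents \<open>1 / (s + 1)\<close> and
  \<open>s / (s + 1)\<close> of the factor 2 add up to one.\<close>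

lemma two_mult_power_eq_powr:
  fixes d :: real
  assumes "d > 0"
  shows "2 * d ^ s = 2 powr (1 / (real s + 1)) * (2 * d ^ (s + 1)) powr (real s / (real s + 1))"
proof -
  have "d ^ (s + 1) = d powr (real s + 1)" using assms by (simp add: powr_realpow add.commute flip: of_nat_Suc)
  then have "(d ^ (s + 1)) powr (real s / (real s + 1)) = d ^ s"
    using assms by (simp add: powr_powr powr_realpow)
  moreover have "2 powr (1 / (real s + 1)) * 2 powr (real s / (real s + 1)) = (2::real)"
  proof -
    have "1 / (real s + 1) + real s / (real s + 1) = 1" by (simp add: field_simps)
    then show ?thesis by (simp flip: powr_add)
  qed
  ultimately show ?thesis using assms by (simp add: powr_mult mult.assoc[symmetric])
qed

theorem theorem1p5:
  fixes s :: nat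
  assumes "s \<ge> 1"
  shows
    "(\<forall>\<^sub>F k :: nat in sequentially. \<forall>F :: 'a ring. field F \<and> card (carrier F) = 2 ^ k \<longrightarrow>
        (let G = AM_group F s; \<Gamma> = AM_graph F s; d = 2 ^ k :: nat; n = card (verts \<Gamma>) in
          G \<cong> product_group {..<1 + k * (s + 1)} (\<lambda>_. integer_mod_group 2) \<and>
          (\<forall>v \<in> verts \<Gamma>. out_degree \<Gamma> v = d) \<and>
          n = 2 * d ^ (s + 1) \<and>
          real (cop_number \<Gamma> \<infinity>) \<le> real n / real d \<and>
          real n / real d = 2 * real d ^ s \<and>
          2 * real d ^ s = 2 powr (1 / (real s + 1)) * real n powr (real s / (real s + 1)))) \<and>
     (\<exists>c > 0. \<exists>c' > 0. \<forall>\<^sub>F k :: nat in sequentially.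
        \<forall>F :: 'a ring. field F \<and> card (carrier F) = 2 ^ k \<longrightarrow>
        (let \<Gamma> = AM_graph F s; f = real (card (verts \<Gamma>)) powr (real s / (real s + 1)) in
          c * f \<le> real (cop_number \<Gamma> (enat s)) \<and> real (cop_number \<Gamma> (enat s)) \<le> c' * f)) \<and>
     (\<exists>c > 0. \<exists>c' > 0. \<forall>\<^sub>F k :: nat in sequentially.
        \<forall>F :: 'a ring. field F \<and> card (carrier F) = 2 ^ k \<longrightarrow>
        (let \<Gamma> = AM_graph F s; f = real (card (verts \<Gamma>)) powr (real s / (real s + 1)) in
          c * f \<le> real (cop_number \<Gamma> \<infinity>) \<and> real (cop_number \<Gamma> \<infinity>) \<le> c' * f))"
proof -
  define K where "K = 16 * real s ^ (2 * s + 3) * (s + 1)"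
  have K: "K > 0" using assms by (simp add: K_def)
  let ?b = "2 powr (1 / (real s + 1)) :: real"
  \<comment> \<open>The threshold \<open>k \<ge> s\<close> provides the at least \<open>s\<close>
    generators from which the robber chooses.\<close>
  have large: "s \<le> 2 ^ k" if "s \<le> k" for k :: nat
    using that less_exp[of k] by linarith
  have n: "card (verts (AM_graph F s)) = 2 * (2 ^ k) ^ (s + 1)" if "card (carrier F) = 2 ^ k"
    for F :: "'a ring" and k
    using that by (simp add: AM_graph_def Cay_def card_AM_group)
  have f: "2 * (2 ^ k) ^ s = ?b * real (card (verts (AM_graph F s))) powr (real s / (real s + 1))"
    if "card (carrier F) = 2 ^ k" for F :: "'a ring" and k
    using two_mult_power_eq_powr[of "2 ^ k" s] n[OF that] by simp
  have theta: "\<exists>c > 0. \<exists>c' > 0. \<forall>\<^sub>F k :: nat in sequentially.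
        \<forall>F :: 'a ring. field F \<and> card (carrier F) = 2 ^ k \<longrightarrow>
        (let \<Gamma> = AM_graph F s; f = real (card (verts \<Gamma>)) powr (real s / (real s + 1)) in
          c * f \<le> real (cop_number \<Gamma> \<tau>) \<and> real (cop_number \<Gamma> \<tau>) \<le> c' * f)"
    if \<tau>: "enat s \<le> \<tau>" for \<tau>
  proof (intro exI conjI)
    show "\<forall>\<^sub>F k :: nat in sequentially. \<forall>F :: 'a ring. field F \<and> card (carrier F) = 2 ^ k \<longrightarrow>
        (let \<Gamma> = AM_graph F s; f = real (card (verts \<Gamma>)) powr (real s / (real s + 1)) in
          ?b / (2 * K) * f \<le> real (cop_number \<Gamma> \<tau>) \<and> real (cop_number \<Gamma> \<tau>) \<le> ?b * f)"
      using eventually_ge_at_top[of s]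
    proof (eventually_elim, intro allI impI, unfold Let_def, intro conjI)
      fix k and F :: "'a ring" assume k: "s \<le> k" and F: "field F \<and> card (carrier F) = 2 ^ k"
      let ?f = "real (card (verts (AM_graph F s))) powr (real s / (real s + 1))"
      interpret binary_field F k using F by (simp add: binary_field_def binary_field_axioms_def)
      \<comment> \<open>\<open>\<tau>\<close> stays arbitrary here, so one argument covers the
        speeds \<open>s\<close> and \<open>\<infinity>\<close>.\<close>
      note bounds = cop_number_AM_graph_bounds[OF assms large[OF k] \<tau>]
      \<comment> \<open>This identity explains both constants: \<open>?b\<close> turns
        \<open>?f\<close> into the upper bound \<open>2 * d ^ s\<close>, and dividing by
        \<open>2 * K\<close> gives the lower bound \<open>d ^ s / K\<close>.\<close>
      have bf: "?b * ?f = 2 * (2 ^ k) ^ s" using f[OF card_carrier] by simp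
      then have "?b / (2 * K) * ?f = (2 ^ k) ^ s / K" by simp
      then show "?b / (2 * K) * ?f \<le> real (cop_number (AM_graph F s) \<tau>)"
        using bounds(1) by (simp add: K_def)
      have "real (cop_number (AM_graph F s) \<tau>) \<le> real (2 * (2 ^ k) ^ s)"
        using bounds(2) by (rule of_nat_mono)
      then show "real (cop_number (AM_graph F s) \<tau>) \<le> ?b * ?f" using bf by simp
    qed
  qed (use K in auto)
  have first: "\<forall>\<^sub>F k :: nat in sequentially. \<forall>F :: 'a ring. field F \<and> card (carrier F) = 2 ^ k \<longrightarrow>
        (let G = AM_group F s; \<Gamma> = AM_graph F s; d = 2 ^ k :: nat; n = card (verts \<Gamma>) in
          G \<cong> product_group {..<1 + k * (s + 1)} (\<lambda>_. integer_mod_group 2) \<and>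
          (\<forall>v \<in> verts \<Gamma>. out_degree \<Gamma> v = d) \<and>
          n = 2 * d ^ (s + 1) \<and>
          real (cop_number \<Gamma> \<infinity>) \<le> real n / real d \<and>
          real n / real d = 2 * real d ^ s \<and>
          2 * real d ^ s = 2 powr (1 / (real s + 1)) * real n powr (real s / (real s + 1)))"
    using eventually_ge_at_top[of s]
  proof (eventually_elim, intro allI impI, unfold Let_def, intro conjI)
    fix k and F :: "'a ring" assume k: "s \<le> k" and F: "field F \<and> card (carrier F) = 2 ^ k"
    then have card: "card (carrier F) = 2 ^ k" by simp
    interpret binary_field F k using F by (simp add: binary_field_def binary_field_axioms_def)
    show "AM_group F s \<cong> product_group {..<1 + k * (s + 1)} (\<lambda>_. integer_mod_group 2)"
      by (rule AM_group_iso)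
    show "\<forall>v\<in>verts (AM_graph F s). out_degree (AM_graph F s) v = 2 ^ k"
      using out_degree_AM_graph by blast
    show "card (verts (AM_graph F s)) = 2 * (2 ^ k) ^ (s + 1)" by (rule n[OF card])
    then show nd: "real (card (verts (AM_graph F s))) / real (2 ^ k) = 2 * real (2 ^ k) ^ s" by simp
    show "real (cop_number (AM_graph F s) \<infinity>) \<le> real (card (verts (AM_graph F s))) / real (2 ^ k)"
      unfolding nd using of_nat_mono[OF cop_number_AM_graph_bounds(2)[OF assms large[OF k], of \<infinity>]]
      by simp
    show "2 * real (2 ^ k) ^ s
        = ?b * real (card (verts (AM_graph F s))) powr (real s / (real s + 1))"
      using f[OF card] by simp
  qed
  show ?thesis using first theta[of "enat s"] theta[of \<infinity>] by simp
qed

end
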